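(* Let $\mathbb{K}\in\{\mathbb{R},\mathbb{C}\}$. Let $\mathfrak{M}$ be the maximal ideal space of the Banach algebra $L^{\infty}(\mathbb{T})$, and let $\mathcal{N}\cup\{\infty\}$ be the one-point compactification of a countably infinite discrete space $\mathcal{N}$. Then the Banach space $C\left(\mathfrak{M}+\mathcal{N}\cup\{\infty\}\right)$ of $\mathbb{K}$-valued continuous functions on the topological sum of $\mathfrak{M}$ and $\mathcal{N}\cup\{\infty\}$ admits an isometric shift.
   Context: $\mathbb{T}$ is the unit circle in $\mathbb{C}$ with Lebesgue measure, and $L^{\infty}(\mathbb{T})$ is the algebra of essentially bounded measurable complex-valued functions on $\mathbb{T}$ (complex-valued whichever $\mathbb{K}$ is used); $\mathfrak{M}$ carries the Gelfand topology. "$+$" denotes topological sum (disjoint union). For a compact Hausdorff space $X$, $C(X)$ is the Banach space of all $\mathbb{K}$-valued continuous functions on $X$ with the supremum norm. A linear operator $T:E\to E$ on a Banach space $E$ is an isometric shift if (1) $T$ is an isometry (not necessarily surjective), (2) $T(E)$ has codimension $1$ in $E$, and (3) $\bigcap_{n=1}^{\infty}T^n(E)=\{0\}$. "$C(X)$ admits an isometric shift" means that such a $T:C(X)\to C(X)$ exists. *)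

theory Defs
  imports "HOL-Analysis.Analysis" "HOL-Algebra.QuotRing" "HOL-Library.Function_Algebras"
begin

section \<open>The algebra of essentially bounded functions on the circle\<close>

text \<open>Arc length measure on the unit circle; the completion makes the measurable sets the Lebesgue
  measurable ones.\<close>

definition circle_measure :: "complex measure" where
  "circle_measure = completion
     (distr (restrict_space lborel {0..<2 * pi}) (restrict_space borel (sphere 0 1)) cis)"

definition ess_bounded_ring :: "'a measure \<Rightarrow> ('a \<Rightarrow> complex) ring" where
  "ess_bounded_ring M =
     \<lparr>carrier = {f \<in> borel_measurable M. \<exists>C. AE x in M. norm (f x) \<le> C},
      mult = (\<lambda>f g x. f x * g x), one = (\<lambda>x. 1), zero = (\<lambda>x. 0), add = (\<lambda>f g x. f x + g x)\<rparr>"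

text \<open>Functions are total on the type, so this ideal also identifies functions that agree on the
  space of the measure and differ only outside it.\<close>

definition null_functions :: "'a measure \<Rightarrow> ('a \<Rightarrow> complex) set" where
  "null_functions M = {f \<in> borel_measurable M. AE x in M. f x = 0}"

definition L_infinity :: "'a measure \<Rightarrow> ('a \<Rightarrow> complex) set ring" where
  "L_infinity M = ess_bounded_ring M Quot null_functions M"

definition L_infinity_const :: "'a measure \<Rightarrow> complex \<Rightarrow> ('a \<Rightarrow> complex) set" where
  "L_infinity_const M c = null_functions M +>\<^bsub>ess_bounded_ring M\<^esub> (\<lambda>x. c)"

lemma cring_ess_bounded_ring: "cring (ess_bounded_ring M)"
proof (rule cringI)
  show "abelian_group (ess_bounded_ring M)"
  proof (rule abelian_groupI)
    fix f g assume "f \<in> carrier (ess_bounded_ring M)" "g \<in> carrier (ess_bounded_ring M)"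
    then obtain C D where fg: "f \<in> borel_measurable M" "g \<in> borel_measurable M"
        "AE x in M. norm (f x) \<le> C" "AE x in M. norm (g x) \<le> D"
      by (auto simp: ess_bounded_ring_def)
    have "AE x in M. norm (f x + g x) \<le> C + D"
      using fg(3,4) by eventually_elim (rule norm_triangle_mono)
    then show "f \<oplus>\<^bsub>ess_bounded_ring M\<^esub> g \<in> carrier (ess_bounded_ring M)"
      using fg(1,2) by (auto simp: ess_bounded_ring_def)
  next
    fix f assume "f \<in> carrier (ess_bounded_ring M)"
    then show "\<exists>g\<in>carrier (ess_bounded_ring M).
        g \<oplus>\<^bsub>ess_bounded_ring M\<^esub> f = \<zero>\<^bsub>ess_bounded_ring M\<^esub>"
      by (intro bexI[of _ "\<lambda>x. - f x"]) (auto simp: ess_bounded_ring_def)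
  qed (auto simp: ess_bounded_ring_def algebra_simps intro: exI[of _ 0])
  show "comm_monoid (ess_bounded_ring M)"
  proof (rule comm_monoidI)
    fix f g assume "f \<in> carrier (ess_bounded_ring M)" "g \<in> carrier (ess_bounded_ring M)"
    then obtain C D where fg: "f \<in> borel_measurable M" "g \<in> borel_measurable M"
        "AE x in M. norm (f x) \<le> C" "AE x in M. norm (g x) \<le> D"
      by (auto simp: ess_bounded_ring_def)
    have "AE x in M. norm (f x * g x) \<le> C * D"
      using fg(3,4)
    proof eventually_elim
      case (elim x)
      then have "0 \<le> C"
        using norm_ge_zero[of "f x"] by linarith
      then show ?case
        using elim by (simp add: norm_mult mult_mono)
    qed
    then show "f \<otimes>\<^bsub>ess_bounded_ring M\<^esub> g \<in> carrier (ess_bounded_ring M)"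
      using fg(1,2) by (auto simp: ess_bounded_ring_def)
  qed (auto simp: ess_bounded_ring_def algebra_simps intro: exI[of _ 1])
qed (auto simp: ess_bounded_ring_def algebra_simps)

lemma ideal_null_functions: "ideal (null_functions M) (ess_bounded_ring M)"
proof -
  interpret cring "ess_bounded_ring M"
    by (rule cring_ess_bounded_ring)
  have sub: "null_functions M \<subseteq> carrier (ess_bounded_ring M)"
    by (auto simp: null_functions_def ess_bounded_ring_def intro!: exI[of _ 0])
  have neg: "\<ominus>\<^bsub>ess_bounded_ring M\<^esub> f = (\<lambda>x. - f x)"
    if "f \<in> carrier (ess_bounded_ring M)" for f
    using that by (intro minus_equality) (auto simp: ess_bounded_ring_def)
  have mult: "(\<lambda>x. f x * g x) \<in> null_functions M"
    if "f \<in> null_functions M" "g \<in> borel_measurable M" for f g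
    using that by (auto simp: null_functions_def)
  show ?thesis
  proof (rule idealI)
    show "subgroup (null_functions M) (add_monoid (ess_bounded_ring M))"
    proof (rule group.subgroupI)
      show "group (add_monoid (ess_bounded_ring M))"
        by (rule a_group)
      show "null_functions M \<subseteq> carrier (add_monoid (ess_bounded_ring M))"
        using sub by simp
      show "null_functions M \<noteq> {}"
        by (auto simp: null_functions_def intro!: exI[of _ "\<lambda>x. 0"])
      show "inv\<^bsub>add_monoid (ess_bounded_ring M)\<^esub> f \<in> null_functions M"
        if "f \<in> null_functions M" for f
      proof -
        have "inv\<^bsub>add_monoid (ess_bounded_ring M)\<^esub> f = (\<lambda>x. - f x)"
          using neg that sub unfolding a_inv_def by blast
        then show ?thesis
          using that by (auto simp: null_functions_def)
      qed
      show "f \<otimes>\<^bsub>add_monoid (ess_bounded_ring M)\<^esub> g \<in> null_functions M"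
        if "f \<in> null_functions M" "g \<in> null_functions M" for f g
        using that by (auto simp: null_functions_def ess_bounded_ring_def)
    qed
  next
    fix f g assume "f \<in> null_functions M" "g \<in> carrier (ess_bounded_ring M)"
    then have "(\<lambda>x. f x * g x) \<in> null_functions M"
      by (intro mult) (auto simp: ess_bounded_ring_def)
    then show "g \<otimes>\<^bsub>ess_bounded_ring M\<^esub> f \<in> null_functions M"
      "f \<otimes>\<^bsub>ess_bounded_ring M\<^esub> g \<in> null_functions M"
      by (simp_all add: ess_bounded_ring_def mult.commute)
  qed (rule ring_axioms)
qed

lemma cring_L_infinity: "cring (L_infinity M)"
  unfolding L_infinity_def
  by (rule ideal.quotient_is_cring[OF ideal_null_functions cring_ess_bounded_ring])


section \<open>The maximal ideal space with the Gelfand topology\<close>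

definition maximal_ideals :: "'a measure \<Rightarrow> ('a \<Rightarrow> complex) set set set" where
  "maximal_ideals M = {I. maximalideal I (L_infinity M)}"

text \<open>By the Gelfand--Mazur theorem every quotient by a maximal ideal consists of the
  complex multiples of the identity; the Gelfand transform of \<open>F\<close> at \<open>I\<close> is the scalar that
  represents \<open>F\<close> modulo \<open>I\<close>.\<close>

definition gelfand_transform ::
    "'a measure \<Rightarrow> ('a \<Rightarrow> complex) set \<Rightarrow> ('a \<Rightarrow> complex) set set \<Rightarrow> complex" where
  "gelfand_transform M F I = (THE c. F \<ominus>\<^bsub>L_infinity M\<^esub> L_infinity_const M c \<in> I)"

definition maximal_ideal_space :: "'a measure \<Rightarrow> ('a \<Rightarrow> complex) set set topology" where
  "maximal_ideal_space M = topology_generated_by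
     {{I \<in> maximal_ideals M. gelfand_transform M F I \<in> U} | F U.
        F \<in> carrier (L_infinity M) \<and> open U}"

lemma topspace_maximal_ideal_space: "topspace (maximal_ideal_space M) = maximal_ideals M"
proof -
  interpret cring "L_infinity M"
    by (rule cring_L_infinity)
  have "{I \<in> maximal_ideals M. gelfand_transform M \<zero>\<^bsub>L_infinity M\<^esub> I \<in> UNIV} = maximal_ideals M"
    by simp
  then show ?thesis
    unfolding maximal_ideal_space_def topology_generated_by_topspace
    using zero_closed open_UNIV by blast
qed


section \<open>Topological sum of two spaces\<close>

text \<open>The library's \<open>sum_topology\<close> requires all summands to have the same type of points.\<close>

definition plus_topology :: "'a topology \<Rightarrow> 'b topology \<Rightarrow> ('a + 'b) topology" where
  "plus_topology X Y = topology (\<lambda>U. openin X (Inl -` U) \<and> openin Y (Inr -` U))"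

lemma openin_plus_topology:
  "openin (plus_topology X Y) U \<longleftrightarrow> openin X (Inl -` U) \<and> openin Y (Inr -` U)"
proof -
  have "istopology (\<lambda>U. openin X (Inl -` U) \<and> openin Y (Inr -` U))"
    by (auto simp: istopology_def vimage_Union intro: openin_Int)
  then show ?thesis
    by (simp add: plus_topology_def topology_inverse')
qed

lemma topspace_plus_topology:
  "topspace (plus_topology X Y) = Inl ` topspace X \<union> Inr ` topspace Y"
proof
  show "topspace (plus_topology X Y) \<subseteq> Inl ` topspace X \<union> Inr ` topspace Y"
  proof
    fix z assume z: "z \<in> topspace (plus_topology X Y)"
    have "Inl -` topspace (plus_topology X Y) \<subseteq> topspace X"
         "Inr -` topspace (plus_topology X Y) \<subseteq> topspace Y"
      using openin_topspace[of "plus_topology X Y"]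
      by (auto simp only: openin_plus_topology intro!: openin_subset)
    with z show "z \<in> Inl ` topspace X \<union> Inr ` topspace Y"
      by (cases z) auto
  qed
  have "Inl -` (Inl ` topspace X \<union> Inr ` topspace Y) = topspace X"
       "Inr -` (Inl ` topspace X \<union> Inr ` topspace Y) = topspace Y"
    by auto
  then show "Inl ` topspace X \<union> Inr ` topspace Y \<subseteq> topspace (plus_topology X Y)"
    by (intro openin_subset) (simp add: openin_plus_topology)
qed


section \<open>Isometric shifts\<close>

text \<open>A normed space is given by a carrier \<open>E\<close> inside an additive group, a scalar multiplication
  and a norm; nothing is required of the operator outside \<open>E\<close>.\<close>

definition isometric_shift ::
    "('k::field \<Rightarrow> 'v::ab_group_add \<Rightarrow> 'v) \<Rightarrow> ('v \<Rightarrow> real) \<Rightarrow> 'v set \<Rightarrow> ('v \<Rightarrow> 'v) \<Rightarrow> bool" where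
  "isometric_shift smul nrm E T \<longleftrightarrow>
     T ` E \<subseteq> E \<and>
     (\<forall>f\<in>E. \<forall>g\<in>E. T (f + g) = T f + T g) \<and>
     (\<forall>c. \<forall>f\<in>E. T (smul c f) = smul c (T f)) \<and>
     (\<forall>f\<in>E. nrm (T f) = nrm f) \<and>
     (\<exists>e\<in>E. e \<notin> T ` E \<and> (\<forall>f\<in>E. \<exists>c. \<exists>g\<in>T ` E. f = smul c e + g)) \<and>
     (\<Inter>n\<in>{1..}. (T ^^ n) ` E) = {0}"

text \<open>Continuity only concerns the points of \<open>X\<close>. Outside them functions are set to \<open>0\<close>, so that
  this is a linear subspace under the pointwise operations.\<close>

definition continuous_functions :: "'a topology \<Rightarrow> ('a \<Rightarrow> 'k::real_normed_field) set" where
  "continuous_functions X =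
     {f. continuous_map X euclidean f \<and> (\<forall>x. x \<notin> topspace X \<longrightarrow> f x = 0)}"

definition sup_norm :: "'a topology \<Rightarrow> ('a \<Rightarrow> 'k::real_normed_field) \<Rightarrow> real" where
  "sup_norm X f = (SUP x\<in>topspace X. norm (f x))"

definition C_admits_isometric_shift :: "'k::real_normed_field itself \<Rightarrow> 'a topology \<Rightarrow> bool" where
  "C_admits_isometric_shift K X \<longleftrightarrow>
     (\<exists>T :: ('a \<Rightarrow> 'k) \<Rightarrow> ('a \<Rightarrow> 'k).
        isometric_shift (\<lambda>c f x. c * f x) (sup_norm X) (continuous_functions X) T)"

end

theory Submission
  imports Defs "HOL-Algebra.Ring_Divisibility"
begin

text \<open>Let \<open>R\<close> be composition with the rotation of the circle by \<open>2 \<pi> \<theta>\<close>, \<open>\<theta>\<close> irrational, carried over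
  to the maximal ideal space by a homeomorphism, and enumerate the isolated points as \<open>e 0, e 1, \<dots>\<close>.
  The shift acts as \<open>- R\<close> on the first summand, moves the value at \<open>e n\<close> to \<open>e (n + 1)\<close>, and places at
  \<open>e 0\<close> the number \<open>\<Delta> f\<close>, where \<open>\<Delta>\<close> integrates a representative of \<open>f\<close> in \<open>L\<^sup>\<infinity>\<close> against a small multiple of
  \<open>exp (- t)\<close>. If \<open>f\<close> lies in every range \<open>T\<^sup>n E\<close>, then the values of \<open>f\<close> at the isolated points are
  \<open>\<plusminus> \<Delta> (R\<^sup>-\<^sup>n f)\<close>, and they converge by continuity at \<open>\<infinity>\<close>. Since orbits of the rotation are dense and the
  signs alternate, all the integrals of translates of \<open>f\<close> against \<open>exp (- t)\<close> over a period vanish; the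
  jump of the periodic extension of \<open>exp (- t)\<close> turns this into \<open>f = 0\<close>.\<close>

section \<open>An oscillating average that determines a periodic function\<close>

text \<open>A rotation acts on the first summand as a surjective isometry, so the codimension has to
  come from the isolated points, and the danger is that some function on the first summand survives
  in all ranges. The sign deals with the constants: with \<open>R\<close> in place of
  \<open>- R\<close>, a constant \<open>c\<close> on the first summand, extended by the value of
  \<Delta> at \<open>c\<close> to all isolated points and to \<infinity>, would be a fixed point of
  the shift. The weight must not be rotation invariant, since \<Delta> would then see only the mean
  value. For \<open>exp (- t)\<close> on one period the Fourier coefficients are multiples of 1 / (1
  + i n), none of them 0, so no nonzero function annihilates all translates of the weight. Its mass
  on a period is below 1, hence the number placed at \<open>e 0\<close> never exceeds the norm of f,
  as the isometry requires. \<Delta> makes sense only once every continuous function on the maximal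
  ideal space is known to come from L^\<infinity>. This is obtained by approximation with simple
  functions, where Zorn's lemma for ideals takes the role of compactness.\<close>

lemma integrable_on_bounded_borel:
  fixes f :: "real \<Rightarrow> real"
  assumes "f \<in> borel_measurable borel" and "\<And>t. t \<in> {x..y} \<Longrightarrow> \<bar>f t\<bar> \<le> C"
  shows "f integrable_on {x..y}"
proof (rule measurable_bounded_by_integrable_imp_integrable)
  have "f \<in> borel_measurable lborel"
    using assms(1) by simp
  then have "f \<in> borel_measurable lebesgue"
    by (rule measurable_completion)
  then show "f \<in> borel_measurable (lebesgue_on {x..y})"
    by (rule measurable_restrict_space1)
  show "(\<lambda>t. C) integrable_on {x..y}"
    by (rule integrable_const_ivl)
qed (use assms(2) in auto)

text \<open>Adding a small multiple of \<open>k\<close> to the constant density 1 gives a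
  nonnegative density \<open>w\<close> under which every interval keeps its length. The measure with
  density \<open>w\<close> is therefore Lebesgue measure, and densities are unique almost
  everywhere. The divisor \<open>\<bar>C\<bar> + 1\<close> keeps \<open>w\<close> nonnegative;
  cutting \<open>k\<close> off below 0 extends the hypothesis to intervals that start to the left of
  0.\<close>

lemma AE_eq_0_if_integrals_eq_0:
  fixes k :: "real \<Rightarrow> real"
  assumes [measurable]: "k \<in> borel_measurable borel"
    and bounded: "\<And>t. t \<ge> 0 \<Longrightarrow> \<bar>k t\<bar> \<le> C"
    and zero: "\<And>x y. 0 \<le> x \<Longrightarrow> x \<le> y \<Longrightarrow> integral {x..y} k = 0"
  shows "AE t in lborel. t \<ge> 0 \<longrightarrow> k t = 0"
proof -
  define w where "w t = 1 + (if t \<ge> 0 then k t / (\<bar>C\<bar> + 1) else 0)" for t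
  have [measurable]: "w \<in> borel_measurable borel"
    unfolding w_def by measurable
  have nonneg: "0 \<le> w t" for t
    using bounded[of t] by (auto simp: w_def field_simps)
  have k_int: "k integrable_on {x..y}" if "0 \<le> x" for x y
    by (rule integrable_on_bounded_borel[where C = C]) (use bounded that in auto)
  have half: "((\<lambda>t. if t \<ge> 0 then k t / (\<bar>C\<bar> + 1) else 0) has_integral 0) {l..u}" if "l \<le> u" for l u
  proof -
    have *: "(k has_integral 0) {max l 0..u}"
    proof (cases "max l 0 \<le> u")
      case True
      then show ?thesis
        using zero[of "max l 0" u] k_int[of "max l 0" u] by (metis integrable_integral max.cobounded2)
    qed auto
    have "((\<lambda>t. k t / (\<bar>C\<bar> + 1)) has_integral 0 / (\<bar>C\<bar> + 1)) {max l 0..u}"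
      using * by (rule has_integral_divide)
    then have "((\<lambda>t. if t \<in> {max l 0..u} then k t / (\<bar>C\<bar> + 1) else 0) has_integral 0) {l..u}"
      by (subst has_integral_restrict) auto
    then show ?thesis
      by (rule has_integral_eq[rotated]) auto
  qed
  have "lborel = density lborel w"
  proof (rule lborel_eqI)
    fix l u :: real assume "\<And>b. b \<in> Basis \<Longrightarrow> l \<bullet> b \<le> u \<bullet> b"
    then have lu: "l \<le> u"
      by simp
    have "(w has_integral (u - l) + 0) {l..u}"
      unfolding w_def
      by (rule has_integral_add[OF _ half[OF lu]]) (use has_integral_const_real[of "1 :: real" l u] lu in simp)
    then have "(\<integral>\<^sup>+t. ennreal (w t) * indicator {l..u} t \<partial>lborel) = ennreal (u - l)"
      by (intro nn_integral_has_integral_lebesgue') (use nonneg in auto)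
    moreover have "(\<integral>\<^sup>+t. ennreal (w t) * indicator {l..u} t \<partial>lborel)
        = (\<integral>\<^sup>+t. ennreal (w t) * indicator (box l u) t \<partial>lborel)"
    proof (rule nn_integral_cong_AE)
      show "AE t in lborel. ennreal (w t) * indicator {l..u} t = ennreal (w t) * indicator (box l u) t"
        using AE_lborel_singleton[of l] AE_lborel_singleton[of u]
        by eventually_elim (auto simp: indicator_def)
    qed
    ultimately show "emeasure (density lborel w) (box l u) = (\<Prod>b\<in>Basis. (u - l) \<bullet> b)"
      by (simp add: emeasure_density)
  qed simp
  then have "density lborel (\<lambda>_. 1) = density lborel (\<lambda>t. ennreal (w t))"
    by (simp add: density_1)
  then have "AE t in lborel. 1 = ennreal (w t)"
    by (intro sigma_finite_measure.density_unique) (auto simp: sigma_finite_lborel)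
  then show ?thesis
    by eventually_elim (auto simp: w_def divide_eq_0_iff ennreal_eq_1 split: if_splits dest!: sym[of 1])
qed

section \<open>Density of irrational orbits with prescribed parity of the index\<close>

lemma approximate_by_multiples:
  fixes \<theta> s \<epsilon> :: real
  assumes "\<theta> \<notin> \<rat>" "\<epsilon> > 0"
  obtains n :: nat and m :: int
    where "n \<ge> M" "even n \<longleftrightarrow> P" "\<bar>of_nat n * (2 * pi * \<theta>) - of_int m * (2 * pi) - s\<bar> < \<epsilon>"
proof -
  \<comment> \<open>Density is applied to \<open>2 * \<theta>\<close>, so the index moves in steps
    of 2 and keeps the parity of the offset \<open>r\<close>; the summand \<open>2 * M\<close> makes
    the index at least \<open>M\<close>.\<close>
  define r :: nat where "r = 2 * M + (if P then 0 else 1)"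
  have "2 * \<theta> \<notin> \<rat>"
  proof
    assume "2 * \<theta> \<in> \<rat>"
    then have "2 * \<theta> / 2 \<in> \<rat>"
      by (intro Rats_divide) auto
    then show False
      using assms by simp
  qed
  then obtain h k where k: "k > 0"
    and *: "\<bar>of_int k * (2 * \<theta>) - of_int h - (s / (2 * pi) - of_nat r * \<theta>)\<bar> < \<epsilon> / (2 * pi)"
    by (rule sequence_of_fractional_parts_is_dense[of "2 * \<theta>" "\<epsilon> / (2 * pi)"]) (use assms in auto)
  define n where "n = 2 * nat k + r"
  have eq: "of_nat n * (2 * pi * \<theta>) - of_int h * (2 * pi) - s
      = 2 * pi * (of_int k * (2 * \<theta>) - of_int h - (s / (2 * pi) - of_nat r * \<theta>))"
    using k by (simp add: n_def field_simps)
  have "\<bar>of_nat n * (2 * pi * \<theta>) - of_int h * (2 * pi) - s\<bar> < \<epsilon>"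
    unfolding eq abs_mult using * by (simp add: field_simps)
  moreover have "n \<ge> M" "even n \<longleftrightarrow> P"
    by (auto simp: n_def r_def)
  ultimately show thesis
    using that by blast
qed

lemma periodic_shift_int:
  fixes F :: "real \<Rightarrow> real"
  assumes "\<And>t. F (t + c) = F t"
  shows "F (t + of_int m * c) = F t"
proof (induction m rule: int_induct[where k = 0])
  case base
  then show ?case by simp
next
  case (step1 i)
  then show ?case
    using assms[of "t + of_int i * c"] by (simp add: algebra_simps)
next
  case (step2 i)
  then show ?case
    using assms[of "t + (of_int i - 1) * c"] by (simp add: algebra_simps)
qed

text \<open>The values of \<open>F\<close> along the even multiples and along the odd multiples of the rotation angle are
  both dense in the range of \<open>F\<close>, so the alternating signs leave \<open>0\<close> as the only value.\<close>

lemma vanishing_if_alternating_orbit_convergent: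
  fixes F :: "real \<Rightarrow> real"
  assumes irrational: "\<theta> \<notin> \<rat>"
    and periodic: "\<And>t. F (t + 2 * pi) = F t"
    and cont: "continuous_on UNIV F"
    and conv: "convergent (\<lambda>n. (-1) ^ n * F (of_nat n * (2 * pi * \<theta>)))"
  shows "F s = 0"
proof -
  obtain L where L: "(\<lambda>n. (-1) ^ n * F (of_nat n * (2 * pi * \<theta>))) \<longlonglongrightarrow> L"
    using conv by (auto simp: convergent_def)
  have "(if P then F s else - F s) = L" for P
  proof (rule dense_eq0_I[THEN eq_iff_diff_eq_0[THEN iffD2]])
    fix \<epsilon> :: real assume "\<epsilon> > 0"
    then obtain M where M: "\<bar>(-1) ^ n * F (of_nat n * (2 * pi * \<theta>)) - L\<bar> < \<epsilon> / 2" if "n \<ge> M" for n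
      using LIMSEQ_D[OF L, of "\<epsilon> / 2"] by auto
    have "\<epsilon> / 2 > 0"
      using \<open>\<epsilon> > 0\<close> by simp
    then obtain \<delta> where \<delta>: "\<delta> > 0" "\<And>t. \<bar>t - s\<bar> < \<delta> \<Longrightarrow> \<bar>F t - F s\<bar> < \<epsilon> / 2"
      using cont unfolding continuous_on_iff dist_real_def by (metis UNIV_I)
    obtain n m where nm: "n \<ge> M" "even n \<longleftrightarrow> P"
        "\<bar>of_nat n * (2 * pi * \<theta>) - of_int m * (2 * pi) - s\<bar> < \<delta>"
      using approximate_by_multiples[OF irrational \<open>\<delta> > 0\<close>] by blast
    have "F (of_nat n * (2 * pi * \<theta>)) = F (of_nat n * (2 * pi * \<theta>) - of_int m * (2 * pi))"
      using periodic_shift_int[of F "2 * pi" "of_nat n * (2 * pi * \<theta>)" "- m", OF periodic] by simp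
    then have F_near: "\<bar>F (of_nat n * (2 * pi * \<theta>)) - F s\<bar> < \<epsilon> / 2"
      using \<delta>(2)[OF nm(3)] by simp
    then show "\<bar>(if P then F s else - F s) - L\<bar> \<le> \<epsilon>"
    proof (cases P)
      case True
      then have "\<bar>F (of_nat n * (2 * pi * \<theta>)) - L\<bar> < \<epsilon> / 2"
        using M[OF nm(1)] nm(2) by simp
      with F_near show ?thesis
        unfolding abs_less_iff abs_le_iff using True by (simp only: if_True) linarith
    next
      case False
      then have "\<bar>- F (of_nat n * (2 * pi * \<theta>)) - L\<bar> < \<epsilon> / 2"
        using M[OF nm(1)] nm(2) by simp
      with F_near show ?thesis
        unfolding abs_less_iff abs_le_iff using False by (simp only: if_False) linarith
    qed
  qed
  from this[of True] this[of False] show ?thesis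
    by simp
qed

text \<open>Substitution turns the average of a translate into \<open>exp s\<close> times the
  integral of \<open>k t = g t * exp (- t)\<close> over the window from \<open>s\<close> to
  \<open>s + 2 * pi\<close>. Once all windows have integral 0, comparing the windows at 0 and at
  \<open>s\<close> shows that \<open>k\<close> has the same integral over \<open>{0..s}\<close> as
  over the translate of this interval by a period, while the latter is
  \<open>exp (- (2 * pi))\<close> times the former. This factor is not 1, so both vanish.\<close>

lemma AE_eq_0_if_averages_convergent:
  fixes g :: "real \<Rightarrow> real"
  assumes irrational: "\<theta> \<notin> \<rat>"
    and [measurable]: "g \<in> borel_measurable borel"
    and bounded: "\<And>t. \<bar>g t\<bar> \<le> B"
    and periodic: "\<And>t. g (t + 2 * pi) = g t"
    and conv: "convergent (\<lambda>n. (-1) ^ n *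
      integral {0..2 * pi} (\<lambda>t. g (t + of_nat n * (2 * pi * \<theta>)) * exp (- t)))"
  shows "AE t in lborel. t \<ge> 0 \<longrightarrow> g t = 0"
proof -
  define k where "k t = g t * exp (- t)" for t
  define F where "F s = integral {0..2 * pi} (\<lambda>t. g (t + s) * exp (- t))" for s
  have [measurable]: "k \<in> borel_measurable borel"
    unfolding k_def by measurable
  \<comment> \<open>\<open>k\<close> is bounded on every half-line to the right but in general not
    on the whole line, because \<open>exp (- t)\<close> grows to the left. This is why vanishing is
    extracted on \<open>t \<ge> 0\<close> only, which still contains full periods.\<close>
  have k_bound: "\<bar>k t\<bar> \<le> B * exp (- x)" if "t \<ge> x" for t x
    using bounded[of t] that unfolding k_def abs_mult by (intro mult_mono) auto
  have k_int: "k integrable_on {x..y}" for x y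
    by (rule integrable_on_bounded_borel[where C = "B * exp (- x)"]) (use k_bound in auto)
  have F_eq: "F s = exp s * integral {s..s + 2 * pi} k" for s
  proof -
    have "F s = integral {0..2 * pi} (\<lambda>t. exp s * (k \<circ> (+) s) t)"
      unfolding F_def k_def by (intro arg_cong[where f = "integral _"]) (auto simp: fun_eq_iff exp_minus exp_add field_simps)
    also have "\<dots> = exp s * integral {0..2 * pi} (k \<circ> (+) s)"
      by (rule integral_mult_right)
    also have "integral {0..2 * pi} (k \<circ> (+) s) = integral {s..s + 2 * pi} k"
      by (subst integral_shift_Icc_real) (simp add: add.commute)
    finally show ?thesis .
  qed
  have F_periodic: "F (s + 2 * pi) = F s" for s
  proof -
    have "g (t + (s + 2 * pi)) = g (t + s)" for t
      using periodic[of "t + s"] by (simp add: add.assoc)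
    then show ?thesis
      by (simp add: F_def)
  qed
  have cont: "continuous_on UNIV F"
  proof -
    have "isCont F s" for s
    proof -
      \<comment> \<open>An indefinite integral of \<open>k\<close> with a base point to the left of
        the points considered. Its domain reaches \<open>s + 1 + 2 * pi\<close> because the window
        of a point near \<open>s\<close> ends one period later.\<close>
      define H where "H x = integral {s - 1..x} k" for x
      have H: "continuous_on {s - 1..s + 1 + 2 * pi} H"
        unfolding H_def by (intro indefinite_integral_continuous_1 k_int)
      have eq: "F x = exp x * (H (x + 2 * pi) - H x)" if "x \<in> {s - 1..s + 1}" for x
      proof -
        have "H (x + 2 * pi) - H x = integral {x..x + 2 * pi} k"
          using Henstock_Kurzweil_Integration.integral_combine[of "s - 1" x "x + 2 * pi" k] that k_int
          by (simp add: H_def)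
        then show ?thesis
          by (simp add: F_eq)
      qed
      have "continuous_on {s - 1..s + 1} (\<lambda>x. exp x * (H (x + 2 * pi) - H x))"
        by (intro continuous_intros continuous_on_compose2[OF H]) auto
      then have "continuous_on {s - 1..s + 1} F"
        by (subst continuous_on_cong[OF refl eq])
      then show ?thesis
        by (rule continuous_on_interior) auto
    qed
    then show ?thesis
      by (simp add: continuous_at_imp_continuous_on)
  qed
  have "F s = 0" for s
    using vanishing_if_alternating_orbit_convergent[OF irrational F_periodic cont] conv
    unfolding F_def by blast
  then have period_integral: "integral {s..s + 2 * pi} k = 0" for s
    using F_eq[of s] by simp
  have from_0: "integral {0..s} k = 0" if "s \<ge> 0" for s
  proof -
    have "integral {0..2 * pi} k + integral {2 * pi..s + 2 * pi} k
        = integral {0..s} k + integral {s..s + 2 * pi} k"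
      using that k_int by (simp add: Henstock_Kurzweil_Integration.integral_combine)
    moreover have "integral {2 * pi..s + 2 * pi} k = exp (- (2 * pi)) * integral {0..s} k"
    proof -
      have "integral {2 * pi..s + 2 * pi} k = integral {0..s} (k \<circ> (+) (2 * pi))"
        by (subst integral_shift_Icc_real) simp
      also have "k \<circ> (+) (2 * pi) = (\<lambda>t. exp (- (2 * pi)) * k t)"
        using periodic by (auto simp: k_def fun_eq_iff exp_diff exp_minus exp_add field_simps)
      finally show ?thesis
        by simp
    qed
    ultimately have "(1 - exp (- (2 * pi))) * integral {0..s} k = 0"
      using period_integral[of 0] period_integral[of s] by (simp add: algebra_simps)
    then show ?thesis
      by simp
  qed
  have "AE t in lborel. t \<ge> 0 \<longrightarrow> k t = 0"
  proof (rule AE_eq_0_if_integrals_eq_0)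
    show "\<bar>k t\<bar> \<le> B" if "t \<ge> 0" for t
      using k_bound[OF that] by simp
    show "integral {x..y} k = 0" if "0 \<le> x" "x \<le> y" for x y
      using Henstock_Kurzweil_Integration.integral_combine[OF that k_int] from_0[of x] from_0[of y] that by simp
  qed simp
  then show ?thesis
    by eventually_elim (simp add: k_def)
qed


section \<open>A shift on a sum with a convergent sequence\<close>

lemma bounded_continuous_functionsI:
  assumes "compact_space Y" "h \<in> continuous_functions Y"
  shows "\<exists>B. \<forall>x. norm (h x) \<le> B"
proof -
  have "compactin euclidean (h ` topspace Y)"
    using image_compactin[of Y "topspace Y" euclidean h] assms
    by (simp add: continuous_functions_def compact_space_def)
  then have "bounded (h ` topspace Y)"
    by (simp add: compact_imp_bounded)
  then obtain B where "norm (h x) \<le> B" if "x \<in> topspace Y" for x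
    by (auto simp: bounded_iff)
  then have "norm (h x) \<le> max B 0" for x
    using assms(2) by (cases "x \<in> topspace Y") (force simp: continuous_functions_def)+
  then show ?thesis
    by blast
qed

section \<open>Continuous functions on a sum and on a one-point compactification\<close>

lemma continuous_functions_plus_topology_iff:
  "f \<in> continuous_functions (plus_topology Y Z) \<longleftrightarrow>
     (\<lambda>x. f (Inl x)) \<in> continuous_functions Y \<and> (\<lambda>z. f (Inr z)) \<in> continuous_functions Z"
proof -
  have "continuous_map (plus_topology Y Z) euclidean f \<longleftrightarrow>
      continuous_map Y euclidean (\<lambda>x. f (Inl x)) \<and> continuous_map Z euclidean (\<lambda>z. f (Inr z))"
    by (simp add: continuous_map_def openin_plus_topology topspace_plus_topology image_iff
        all_conj_distrib imp_conjR)
  moreover have "(\<forall>x. x \<notin> topspace (plus_topology Y Z) \<longrightarrow> f x = 0) \<longleftrightarrow>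
      (\<forall>x. x \<notin> topspace Y \<longrightarrow> f (Inl x) = 0) \<and> (\<forall>z. z \<notin> topspace Z \<longrightarrow> f (Inr z) = 0)"
    by (auto simp: topspace_plus_topology split_sum_all)
  ultimately show ?thesis
    unfolding continuous_functions_def mem_Collect_eq by argo
qed

text \<open>Compact sets of a discrete space are finite, so the neighbourhoods of
  \<open>None\<close> are the cofinite sets containing it, and continuity becomes convergence along
  an enumeration. In this form it is plain that moving the values by one index preserves
  continuity.\<close>

lemma continuous_functions_Alexandroff_iff:
  fixes g :: "'n option \<Rightarrow> 'k::real_normed_field"
  assumes e: "bij_betw e (UNIV :: nat set) N"
  shows "g \<in> continuous_functions (Alexandroff_compactification (discrete_topology N)) \<longleftrightarrow>
    (\<forall>x. x \<notin> N \<longrightarrow> g (Some x) = 0) \<and> (\<lambda>n. g (Some (e n))) \<longlonglongrightarrow> g None"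
proof -
  let ?Z = "Alexandroff_compactification (discrete_topology N)"
  have inj: "inj e" and range: "range e = N"
    using e by (auto simp: bij_betw_def)
  have "continuous_map ?Z euclidean g \<longleftrightarrow> (\<lambda>n. g (Some (e n))) \<longlonglongrightarrow> g None"
  proof
    assume cont: "continuous_map ?Z euclidean g"
    show "(\<lambda>n. g (Some (e n))) \<longlonglongrightarrow> g None"
    proof (rule topological_tendstoI)
      fix U assume U: "open U" "g None \<in> U"
      have "openin ?Z {z \<in> topspace ?Z. g z \<in> U}"
        using cont U(1) by (simp add: continuous_map_def)
      then obtain C where C: "compactin (discrete_topology N) C"
          "{z \<in> topspace ?Z. g z \<in> U} = insert None (Some ` (N - C))"
        using U(2) by (auto simp: openin_Alexandroff_compactification)
      have "finite {n. e n \<in> C}"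
        using C(1) inj by (auto simp: compactin_discrete_topology intro: finite_vimageI[of C e, unfolded vimage_def])
      then have "\<forall>\<^sub>F n in sequentially. e n \<notin> C"
        by (simp add: eventually_cofinite flip: cofinite_eq_sequentially)
      then show "\<forall>\<^sub>F n in sequentially. g (Some (e n)) \<in> U"
      proof eventually_elim
        case (elim n)
        then have "Some (e n) \<in> {z \<in> topspace ?Z. g z \<in> U}"
          unfolding C(2) using range by auto
        then show ?case
          by simp
      qed
    qed
  next
    assume lim: "(\<lambda>n. g (Some (e n))) \<longlonglongrightarrow> g None"
    have "openin ?Z {z \<in> topspace ?Z. g z \<in> U}" if "open U" for U
    proof (cases "g None \<in> U")
      case True
      define C where "C = {x \<in> N. g (Some x) \<notin> U}"
      have "\<forall>\<^sub>F n in sequentially. g (Some (e n)) \<in> U"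
        using lim that True by (rule topological_tendstoD)
      then have "finite {n. g (Some (e n)) \<notin> U}"
        by (simp add: eventually_cofinite flip: cofinite_eq_sequentially)
      moreover have "C = e ` {n. g (Some (e n)) \<notin> U}"
        using range by (auto simp: C_def)
      ultimately have "finite C"
        by simp
      moreover have "{z \<in> topspace ?Z. g z \<in> U} = insert None (Some ` (N - C))"
        using True by (auto simp: C_def)
      ultimately show ?thesis
        unfolding openin_Alexandroff_compactification
        by (intro disjI2 exI[of _ C]) (simp add: compactin_discrete_topology C_def)
    next
      case False
      then have "{z \<in> topspace ?Z. g z \<in> U} = Some ` {x \<in> N. g (Some x) \<in> U}"
        by auto
      then show ?thesis
        by (simp add: openin_Alexandroff_compactification_image_Some)
    qed
    then show "continuous_map ?Z euclidean g"
      by (simp add: continuous_map_def)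
  qed
  moreover have "(\<forall>z. z \<notin> topspace ?Z \<longrightarrow> g z = 0) \<longleftrightarrow> (\<forall>x. x \<notin> N \<longrightarrow> g (Some x) = 0)"
    by (auto simp: image_iff)
  ultimately show ?thesis
    by (auto simp: continuous_functions_def)
qed

lemma continuous_functions_cmult:
  fixes h :: "'a \<Rightarrow> 'k::real_normed_field"
  assumes "h \<in> continuous_functions Y"
  shows "(\<lambda>x. c * h x) \<in> continuous_functions Y"
proof -
  have "continuous_map Y euclidean ((*) c \<circ> h)"
    by (rule continuous_map_compose[of Y euclidean])
      (use assms in \<open>simp_all add: continuous_functions_def continuous_on_mult_left\<close>)
  then show ?thesis
    using assms by (simp add: continuous_functions_def o_def)
qed

lemma continuous_functions_uminus_compose:
  fixes h :: "'a \<Rightarrow> 'k::real_normed_field"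
  assumes "h \<in> continuous_functions Y" "continuous_map Y Y \<phi>"
  shows "(\<lambda>x. if x \<in> topspace Y then - h (\<phi> x) else 0) \<in> continuous_functions Y"
proof -
  have "continuous_map Y euclidean (uminus \<circ> (h \<circ> \<phi>))"
  proof (rule continuous_map_compose[of Y euclidean])
    show "continuous_map Y euclidean (h \<circ> \<phi>)"
      using assms by (intro continuous_map_compose[of Y Y \<phi> euclidean h]) (auto simp: continuous_functions_def)
    show "continuous_map euclidean euclidean (uminus :: 'k \<Rightarrow> 'k)"
      by (simp add: continuous_on_minus)
  qed
  then have "continuous_map Y euclidean (\<lambda>x. if x \<in> topspace Y then - h (\<phi> x) else 0)"
    by (rule continuous_map_eq) simp
  then show ?thesis
    by (simp add: continuous_functions_def)
qed

lemma sup_norm_le: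
  assumes "topspace Y \<noteq> {}" "\<And>x. norm (f x) \<le> B"
  shows "sup_norm Y f \<le> B"
  unfolding sup_norm_def using assms by (intro cSUP_least) auto

text \<open>Outside the space the function is 0, and the supremum over a nonempty space is at least
  0; hence the bound is available at every point of the type.\<close>

lemma norm_le_sup_norm:
  assumes "f \<in> continuous_functions Y" "\<exists>B. \<forall>x. norm (f x) \<le> B" "topspace Y \<noteq> {}"
  shows "norm (f x) \<le> sup_norm Y f"
proof -
  have bdd: "bdd_above ((\<lambda>x. norm (f x)) ` topspace Y)"
    using assms(2) by (auto simp: bdd_above_def)
  have in_space: "norm (f y) \<le> sup_norm Y f" if "y \<in> topspace Y" for y
    unfolding sup_norm_def by (rule cSUP_upper[OF that bdd])
  show ?thesis
  proof (cases "x \<in> topspace Y")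
    case False
    obtain y where "y \<in> topspace Y"
      using assms(3) by blast
    then have "0 \<le> sup_norm Y f"
      using in_space[of y] norm_ge_zero[of "f y"] by linarith
    then show ?thesis
      using False assms(1) by (simp add: continuous_functions_def)
  qed (rule in_space)
qed

text \<open>Separates the construction of the shift from the analysis on the circle.
  \<open>\<Delta>\<close> is a linear functional of norm at most 1; compactness of \<open>Y\<close>
  enters through \<open>bounded\<close>; and \<open>separating\<close> speaks of the sequence that,
  up to an index shift and a sign, a function in all ranges carries on the isolated points.\<close>

theorem isometric_shift_on_sum:
  fixes \<Delta> :: "('a \<Rightarrow> 'k::real_normed_field) \<Rightarrow> 'k" and N :: "'n set"
  assumes N: "countable N" "infinite N"
    and \<phi>: "homeomorphic_maps Y Y \<phi> \<psi>"
    and \<Delta>_add: "\<And>h k. h \<in> continuous_functions Y \<Longrightarrow> k \<in> continuous_functions Y \<Longrightarrow>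
      \<Delta> (\<lambda>x. h x + k x) = \<Delta> h + \<Delta> k"
    and \<Delta>_cmult: "\<And>c h. h \<in> continuous_functions Y \<Longrightarrow> \<Delta> (\<lambda>x. c * h x) = c * \<Delta> h"
    and \<Delta>_bound: "\<And>B h. h \<in> continuous_functions Y \<Longrightarrow> (\<And>x. norm (h x) \<le> B) \<Longrightarrow> norm (\<Delta> h) \<le> B"
    and bounded: "\<And>h :: 'a \<Rightarrow> 'k. h \<in> continuous_functions Y \<Longrightarrow> \<exists>B. \<forall>x. norm (h x) \<le> B"
    and separating: "\<And>h. h \<in> continuous_functions Y \<Longrightarrow>
      convergent (\<lambda>n. (-1) ^ n * \<Delta> (\<lambda>x. if x \<in> topspace Y then h ((\<psi> ^^ n) x) else 0)) \<Longrightarrow> h = (\<lambda>x. 0)"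
  shows "C_admits_isometric_shift TYPE('k)
    (plus_topology Y (Alexandroff_compactification (discrete_topology N)))"
proof -
  let ?Z = "Alexandroff_compactification (discrete_topology N)"
  let ?X = "plus_topology Y ?Z"
  let ?E = "continuous_functions ?X :: ('a + 'n option \<Rightarrow> 'k) set"
  obtain e :: "nat \<Rightarrow> 'n" where e: "bij_betw e UNIV N"
    using N bij_betw_from_nat_into by blast
  define ix where "ix = inv_into UNIV e"
  have ix [simp]: "ix (e n) = n" and e_N [simp]: "e n \<in> N" for n
    using e by (auto simp: ix_def bij_betw_def)
  have N_cases: "\<exists>n. x = e n" if "x \<in> N" for x
    using e that by (auto simp: bij_betw_def)
  have contY: "continuous_map Y Y \<phi>" "continuous_map Y Y \<psi>"
    and \<psi>\<phi>: "\<And>x. x \<in> topspace Y \<Longrightarrow> \<psi> (\<phi> x) = x" and \<phi>\<psi>: "\<And>x. x \<in> topspace Y \<Longrightarrow> \<phi> (\<psi> x) = x"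
    using \<phi> by (auto simp: homeomorphic_maps_def)
  have \<phi>_in: "\<phi> x \<in> topspace Y" and \<psi>_in: "\<psi> x \<in> topspace Y" if "x \<in> topspace Y" for x
    using contY that by (auto simp: continuous_map_def)
  have E_iff: "f \<in> ?E \<longleftrightarrow> (\<lambda>x. f (Inl x)) \<in> continuous_functions Y \<and>
      (\<forall>x. x \<notin> N \<longrightarrow> f (Inr (Some x)) = 0) \<and> (\<lambda>n. f (Inr (Some (e n)))) \<longlonglongrightarrow> f (Inr None)" for f
    by (simp add: continuous_functions_plus_topology_iff continuous_functions_Alexandroff_iff[OF e])
  have E_Inl: "(\<lambda>x. f (Inl x)) \<in> continuous_functions Y" if "f \<in> ?E" for f
    using that unfolding E_iff by blast
  have E_out: "f (Inl x) = 0" if "f \<in> ?E" "x \<notin> topspace Y" for f x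
    using E_Inl[OF that(1)] that(2) by (simp add: continuous_functions_def)
  have E_outN: "f (Inr (Some x)) = 0" if "f \<in> ?E" "x \<notin> N" for f x
    using that by (simp add: E_iff)
  define T :: "('a + 'n option \<Rightarrow> 'k) \<Rightarrow> 'a + 'n option \<Rightarrow> 'k" where
    "T f z = (case z of Inl x \<Rightarrow> if x \<in> topspace Y then - f (Inl (\<phi> x)) else 0
       | Inr None \<Rightarrow> f (Inr None)
       | Inr (Some x) \<Rightarrow> if x \<notin> N then 0 else
           (case ix x of 0 \<Rightarrow> \<Delta> (\<lambda>y. f (Inl y)) | Suc n \<Rightarrow> f (Inr (Some (e n)))))" for f z
  \<comment> \<open>A left inverse of \<open>T\<close> on the space: it undoes the composition with
    \<open>\<phi>\<close> and drops the value at \<open>e 0\<close>, which \<open>T\<close> had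
    computed from the first component.\<close>
  define S :: "('a + 'n option \<Rightarrow> 'k) \<Rightarrow> 'a + 'n option \<Rightarrow> 'k" where
    "S f z = (case z of Inl x \<Rightarrow> if x \<in> topspace Y then - f (Inl (\<psi> x)) else 0
       | Inr None \<Rightarrow> f (Inr None)
       | Inr (Some x) \<Rightarrow> if x \<notin> N then 0 else f (Inr (Some (e (Suc (ix x))))))" for f z
  define p :: "'a + 'n option \<Rightarrow> 'k" where "p z = (if z = Inr (Some (e 0)) then 1 else 0)" for z
  have T_simps [simp]: "T f (Inl x) = (if x \<in> topspace Y then - f (Inl (\<phi> x)) else 0)"
      "T f (Inr None) = f (Inr None)" "T f (Inr (Some (e 0))) = \<Delta> (\<lambda>y. f (Inl y))"
      "T f (Inr (Some (e (Suc n)))) = f (Inr (Some (e n)))"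
      "y \<notin> N \<Longrightarrow> T f (Inr (Some y)) = 0" for f x n y
    by (auto simp: T_def)
  have S_simps [simp]: "S f (Inl x) = (if x \<in> topspace Y then - f (Inl (\<psi> x)) else 0)"
      "S f (Inr None) = f (Inr None)" "S f (Inr (Some (e n))) = f (Inr (Some (e (Suc n))))"
      "y \<notin> N \<Longrightarrow> S f (Inr (Some y)) = 0" for f x n y
    by (auto simp: S_def)
  have X_ext: "f = g" if "\<And>x. f (Inl x) = g (Inl x)" "f (Inr None) = g (Inr None)"
      "\<And>n. f (Inr (Some (e n))) = g (Inr (Some (e n)))"
      "\<And>x. x \<notin> N \<Longrightarrow> f (Inr (Some x)) = g (Inr (Some x))" for f g :: "'a + 'n option \<Rightarrow> 'k"
  proof
    fix z
    show "f z = g z"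
    proof (cases z)
      case (Inr y)
      then show ?thesis
        using that(2-4) N_cases by (cases y) (auto, metis)
    qed (use that(1) in simp)
  qed
  have T_E: "T f \<in> ?E" if "f \<in> ?E" for f
  proof -
    have "(\<lambda>n. T f (Inr (Some (e (Suc n))))) \<longlonglongrightarrow> T f (Inr None)"
      using that by (simp add: E_iff)
    then have "(\<lambda>n. T f (Inr (Some (e n)))) \<longlonglongrightarrow> T f (Inr None)"
      by (rule LIMSEQ_imp_Suc)
    then show ?thesis
      using that continuous_functions_uminus_compose[OF _ contY(1), of "\<lambda>x. f (Inl x)"]
      by (simp add: E_iff)
  qed
  have S_E: "S f \<in> ?E" if "f \<in> ?E" for f
    using that continuous_functions_uminus_compose[OF _ contY(2), of "\<lambda>x. f (Inl x)"]
    by (auto simp: E_iff intro: LIMSEQ_Suc)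
  have S_T: "S (T f) = f" if "f \<in> ?E" for f
    by (rule X_ext) (use that \<psi>_in \<phi>\<psi> in \<open>auto simp: E_out E_outN\<close>)
  \<comment> \<open>\<open>T (S f)\<close> agrees with \<open>f\<close> except at
    \<open>e 0\<close>, where its value is forced to be \<open>\<Delta>\<close> of the first
    component of \<open>S f\<close>. A multiple of \<open>p\<close> repairs this one point, so the
    range together with \<open>p\<close> spans the space.\<close>
  have T_S: "f = (\<lambda>z. (f (Inr (Some (e 0))) - \<Delta> (\<lambda>y. S f (Inl y))) * p z + T (S f) z)"
    if "f \<in> ?E" for f
  proof (rule X_ext)
    fix n
    show "f (Inr (Some (e n))) =
        (f (Inr (Some (e 0))) - \<Delta> (\<lambda>y. S f (Inl y))) * p (Inr (Some (e n))) + T (S f) (Inr (Some (e n)))"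
    proof (cases n)
      case (Suc m)
      have "e (Suc m) \<noteq> e 0"
        by (metis ix nat.distinct(1))
      then show ?thesis
        by (simp add: p_def Suc)
    qed (simp add: p_def)
  qed (use that \<phi>_in \<psi>\<phi> in \<open>auto simp: E_out E_outN p_def\<close>)
  have p_E: "p \<in> ?E"
  proof -
    have "p (Inr (Some (e (Suc n)))) = 0" for n
      unfolding p_def by (metis ix nat.distinct(1) sum.inject(2) option.inject)
    then have "(\<lambda>n. p (Inr (Some (e (Suc n))))) \<longlonglongrightarrow> 0"
      by simp
    then have "(\<lambda>n. p (Inr (Some (e n)))) \<longlonglongrightarrow> p (Inr None)"
      by (subst (asm) filterlim_sequentially_Suc) (simp add: p_def)
    moreover have "(\<lambda>x. 0) \<in> (continuous_functions Y :: ('a \<Rightarrow> 'k) set)"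
      by (simp add: continuous_functions_def)
    ultimately show ?thesis
      by (auto simp: E_iff p_def)
  qed
  have bounded_E: "\<exists>B. \<forall>z. norm (f z) \<le> B" if "f \<in> ?E" for f
  proof -
    have f: "(\<lambda>x. f (Inl x)) \<in> continuous_functions Y" "(\<lambda>z. f (Inr z)) \<in> continuous_functions ?Z"
      using that by (auto simp: continuous_functions_plus_topology_iff)
    obtain B1 where B1: "norm (f (Inl x)) \<le> B1" for x
      using bounded[OF f(1)] by blast
    obtain B2 where B2: "norm (f (Inr z)) \<le> B2" for z
      using bounded_continuous_functionsI[OF compact_space_Alexandroff_compactification f(2)] by blast
    have "norm (f z) \<le> max B1 B2" for z
      by (cases z) (use B1 B2 in \<open>auto simp: le_max_iff_disj\<close>)
    then show ?thesis
      by blast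
  qed
  have X_nonempty: "topspace ?X \<noteq> {}"
    by (auto simp: topspace_plus_topology)
  note le_sup = norm_le_sup_norm[OF _ bounded_E X_nonempty]
  have isometry: "sup_norm ?X (T f) = sup_norm ?X f" if f: "f \<in> ?E" for f
  proof (rule antisym)
    note le = le_sup[OF f f]
    have "norm (T f z) \<le> sup_norm ?X f" for z
    proof (cases z)
      case (Inl x)
      show ?thesis
        using le[of "Inl (\<phi> x)"] order_trans[OF norm_ge_zero le] by (simp add: Inl)
    next
      case (Inr y)
      show ?thesis
      proof (cases "y = None \<or> (\<exists>x. x \<notin> N \<and> y = Some x)")
        case True
        then show ?thesis
          using le[of "Inr None"] order_trans[OF norm_ge_zero le] by (auto simp: Inr)
      next
        case False
        then obtain n where n: "y = Some (e n)"
          using N_cases by (cases y) auto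
        show ?thesis
        proof (cases n)
          case 0
          have "norm (\<Delta> (\<lambda>y. f (Inl y))) \<le> sup_norm ?X f"
            using f le by (intro \<Delta>_bound) (auto simp: E_iff)
          then show ?thesis
            by (simp add: Inr n 0)
        next
          case (Suc m)
          then show ?thesis
            using le by (simp add: Inr n)
        qed
      qed
    qed
    then show "sup_norm ?X (T f) \<le> sup_norm ?X f"
      by (rule sup_norm_le[OF X_nonempty])
    \<comment> \<open>For the converse inequality \<open>f\<close> is recovered as
      \<open>S (T f)\<close>, each value of which is 0 or, up to sign, a value of
      \<open>T f\<close>.\<close>
    note le' = le_sup[OF T_E[OF f] T_E[OF f]]
    have "norm (f z) \<le> sup_norm ?X (T f)" for z
    proof -
      have "norm (S (T f) z) \<le> sup_norm ?X (T f)"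
      proof (cases z)
        case (Inl x)
        show ?thesis
          unfolding Inl S_simps using le'[of "Inl (\<psi> x)"] order_trans[OF norm_ge_zero le'] by simp
      next
        case (Inr y)
        show ?thesis
        proof (cases "\<exists>n. y = Some (e n)")
          case True
          then obtain n where "y = Some (e n)" ..
          then show ?thesis
            unfolding Inr using le'[of "Inr (Some (e (Suc n)))"] by simp
        next
          case False
          then show ?thesis
            using le'[of "Inr None"] order_trans[OF norm_ge_zero le'] N_cases
            by (cases y) (auto simp: Inr S_def)
        qed
      qed
      then show ?thesis
        by (simp add: S_T[OF f])
    qed
    then show "sup_norm ?X f \<le> sup_norm ?X (T f)"
      by (rule sup_norm_le[OF X_nonempty])
  qed
  have \<Delta>_0: "\<Delta> (\<lambda>x. 0) = 0"
    using \<Delta>_cmult[of "\<lambda>x. 0" 0] by (simp add: continuous_functions_def)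
  \<comment> \<open>If \<open>p = T f\<close>, then \<open>f\<close> vanishes on \<open>Y\<close>,
    because \<open>\<phi>\<close> is onto; hence \<open>T f\<close> is 0 at \<open>e 0\<close>,
    where \<open>p\<close> is 1.\<close>
  have p_notin: "p \<notin> T ` ?E"
  proof
    assume "p \<in> T ` ?E"
    then obtain f where f: "f \<in> ?E" "p = T f"
      by auto
    then have T_f: "T f z = p z" for z
      by simp
    have "f (Inl x) = 0" for x
    proof (cases "x \<in> topspace Y")
      case True
      then show ?thesis
        using T_f[of "Inl (\<psi> x)"] by (simp add: p_def \<psi>_in \<phi>\<psi>)
    qed (rule E_out[OF f(1)])
    then have "T f (Inr (Some (e 0))) = 0"
      by (simp add: \<Delta>_0)
    then show False
      using T_f[of "Inr (Some (e 0))"] by (simp add: p_def)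
  qed
  have T_pow_E: "(T ^^ n) f \<in> ?E" if "f \<in> ?E" for f n
    by (induction n) (use that T_E in auto)
  have T_pow_N: "(T ^^ n) f (Inr (Some (e n))) = f (Inr (Some (e 0)))" for f n
    by (induction n) simp_all
  have \<psi>_pow_in: "(\<psi> ^^ n) x \<in> topspace Y" if "x \<in> topspace Y" for n x
    by (induction n) (use that \<psi>_in in auto)
  have T_pow_Y: "f (Inl x) = (-1) ^ n * (T ^^ n) f (Inl ((\<psi> ^^ n) x))" if "x \<in> topspace Y" for f n x
  proof (induction n)
    case (Suc n)
    have "(T ^^ Suc n) f (Inl ((\<psi> ^^ Suc n) x)) = - (T ^^ n) f (Inl ((\<psi> ^^ n) x))"
      using \<psi>_pow_in[OF that, of n] by (simp add: \<psi>_in \<phi>\<psi>)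
    then show ?case
      using Suc by simp
  qed simp
  have inter: "f = (\<lambda>z. 0)" if f: "\<And>n. n \<ge> 1 \<Longrightarrow> f \<in> (T ^^ n) ` ?E" for f
  proof -
    let ?h = "\<lambda>x. f (Inl x)"
    have "f \<in> T ` ?E"
      using f[of 1] by simp
    then have f_E: "f \<in> ?E"
      using T_E by auto
    then have h_E: "?h \<in> continuous_functions Y" and lim: "(\<lambda>n. f (Inr (Some (e n)))) \<longlonglongrightarrow> f (Inr None)"
      unfolding E_iff by auto
    \<comment> \<open>The value at \<open>e n\<close> was written to \<open>e 0\<close> by one
      application of \<open>T\<close> and then moved by \<open>n\<close> further ones, so
      \<open>Suc n\<close> applications are needed to trace it. It is \<open>\<Delta>\<close> of the
      first component of the preimage \<open>g\<close> under \<open>T ^^ Suc n\<close>, and that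
      component is \<open>f\<close> composed with \<open>\<psi> ^^ Suc n\<close>, up to
      sign.\<close>
    have e_val: "f (Inr (Some (e n))) = \<Delta> (\<lambda>x. (-1) ^ Suc n * (if x \<in> topspace Y then ?h ((\<psi> ^^ Suc n) x) else 0))" for n
    proof -
      obtain g where g: "g \<in> ?E" "f = (T ^^ Suc n) g"
        using f[of "Suc n"] by auto
      have g_eq: "g (Inl x) = (-1) ^ Suc n * (if x \<in> topspace Y then ?h ((\<psi> ^^ Suc n) x) else 0)" for x
      proof (cases "x \<in> topspace Y")
        case True
        then show ?thesis
          using T_pow_Y[OF True, of g "Suc n"] by (simp only: g(2) if_True)
      next
        case False
        then show ?thesis
          using g(1) by (simp add: E_out)
      qed
      have "f (Inr (Some (e n))) = T g (Inr (Some (e 0)))"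
        using T_pow_N[of n "T g"] by (simp add: g(2) funpow_swap1)
      then show ?thesis
        by (simp only: T_simps(3) g_eq)
    qed
    have cont_pow: "(\<lambda>x. if x \<in> topspace Y then ?h ((\<psi> ^^ n) x) else 0) \<in> continuous_functions Y" for n
    proof -
      have "continuous_map Y Y (\<psi> ^^ n)"
      proof (induction n)
        case (Suc n)
        then show ?case
          using contY(2) unfolding funpow.simps by (rule continuous_map_compose)
      qed simp
      then have "continuous_map Y euclidean (?h \<circ> (\<psi> ^^ n))"
        by (rule continuous_map_compose[of Y Y]) (use h_E in \<open>simp add: continuous_functions_def\<close>)
      then have "continuous_map Y euclidean (\<lambda>x. if x \<in> topspace Y then ?h ((\<psi> ^^ n) x) else 0)"
        by (rule continuous_map_eq) simp
      then show ?thesis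
        by (simp add: continuous_functions_def)
    qed
    have e_val': "f (Inr (Some (e n))) = (-1) ^ Suc n * \<Delta> (\<lambda>x. if x \<in> topspace Y then ?h ((\<psi> ^^ Suc n) x) else 0)" for n
      unfolding e_val by (rule \<Delta>_cmult[OF cont_pow])
    \<comment> \<open>The values at the isolated points start with the index \<open>Suc 0\<close>;
      prepending one term does not affect convergence.\<close>
    have "convergent (\<lambda>n. (-1) ^ n * \<Delta> (\<lambda>x. if x \<in> topspace Y then ?h ((\<psi> ^^ n) x) else 0))"
      using convergentI[OF lim] unfolding e_val' by (rule convergent_Suc_iff[THEN iffD1])
    then have "?h = (\<lambda>x. 0)"
      by (rule separating[OF h_E])
    then have h0: "f (Inl x) = 0" for x
      by (rule fun_cong)
    have e0: "f (Inr (Some (e n))) = 0" for n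
      by (simp add: e_val' h0 \<Delta>_0 cong: if_cong)
    then have "f (Inr None) = 0"
      using lim by (simp add: LIMSEQ_const_iff)
    then show ?thesis
      by (intro X_ext) (simp_all add: h0 e0 E_outN[OF f_E])
  qed
  have "isometric_shift (\<lambda>c f x. c * f x) (sup_norm ?X) ?E T"
    unfolding isometric_shift_def
  proof (intro conjI ballI allI)
    show "T ` ?E \<subseteq> ?E"
      using T_E by blast
    show "T (f + g) = T f + T g" if "f \<in> ?E" "g \<in> ?E" for f g
    proof (rule X_ext)
      show "T (f + g) (Inr (Some (e n))) = (T f + T g) (Inr (Some (e n)))" for n
        by (cases n) (simp_all add: E_Inl \<Delta>_add that)
    qed simp_all
    show "T (\<lambda>x. c * f x) = (\<lambda>x. c * T f x)" if "f \<in> ?E" for c f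
    proof (rule X_ext)
      show "T (\<lambda>x. c * f x) (Inr (Some (e n))) = c * T f (Inr (Some (e n)))" for n
        by (cases n) (simp_all add: E_Inl \<Delta>_cmult that)
    qed simp_all
    show "sup_norm ?X (T f) = sup_norm ?X f" if "f \<in> ?E" for f
      by (rule isometry[OF that])
    show "\<exists>q\<in>?E. q \<notin> T ` ?E \<and> (\<forall>f\<in>?E. \<exists>c. \<exists>g\<in>T ` ?E. f = (\<lambda>x. c * q x) + g)"
    proof (intro bexI[of _ p] conjI ballI)
      fix f assume f: "f \<in> ?E"
      show "\<exists>c. \<exists>g\<in>T ` ?E. f = (\<lambda>x. c * p x) + g"
        using T_S[OF f] S_E[OF f] unfolding plus_fun_def by blast
    qed (use p_notin p_E in auto)
    have zero_in: "(\<lambda>z. 0) \<in> (T ^^ n) ` ?E" for n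
    proof
      have "T (\<lambda>z. 0) = (\<lambda>z. 0)"
      proof (rule X_ext)
        show "T (\<lambda>z. 0) (Inr (Some (e n))) = 0" for n
          by (cases n) (simp_all add: \<Delta>_0)
      qed simp_all
      then show "(\<lambda>z. 0) = (T ^^ n) (\<lambda>z. 0)"
        by (induction n) auto
      show "(\<lambda>z. 0) \<in> ?E"
        by (simp add: continuous_functions_def)
    qed
    show "(\<Inter>n\<in>{1..}. (T ^^ n) ` ?E) = {0}"
    proof (intro equalityI subsetI)
      fix f assume f: "f \<in> (\<Inter>n\<in>{1..}. (T ^^ n) ` ?E)"
      have "f \<in> (T ^^ n) ` ?E" if "n \<ge> 1" for n
        using INT_D[OF f, of n] that by simp
      then show "f \<in> {0}"
        using inter[of f] by (simp add: zero_fun_def)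
    next
      fix f :: "'a + 'n option \<Rightarrow> 'k" assume "f \<in> {0}"
      then have f: "f = (\<lambda>z. 0)"
        by (simp add: zero_fun_def)
      show "f \<in> (\<Inter>n\<in>{1..}. (T ^^ n) ` ?E)"
        unfolding f by (intro INT_I zero_in)
    qed
  qed
  then show ?thesis
    unfolding C_admits_isometric_shift_def by (intro exI[of _ T])
qed


section \<open>Maximal ideals of rings and quotient rings\<close>

text \<open>A union of a chain of ideals that avoid \<open>\<one>\<close> avoids
  \<open>\<one>\<close> as well, so Zorn's lemma applies to the proper ideals above
  \<open>J\<close>.\<close>

lemma (in cring) ex_maximalideal:
  assumes "ideal J R" "\<one> \<notin> J"
  obtains I where "maximalideal I R" "J \<subseteq> I"
proof -
  let ?A = "{I. ideal I R \<and> J \<subseteq> I \<and> \<one> \<notin> I}"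
  have "\<exists>I\<in>?A. \<forall>K\<in>?A. I \<subseteq> K \<longrightarrow> K = I"
  proof (rule subset_Zorn_nonempty)
    show "?A \<noteq> {}"
      using assms by blast
    fix C assume C: "C \<noteq> {}" "subset.chain ?A C"
    then have "subset.chain {I. ideal I R} C"
      by (auto simp: pred_on.chain_def)
    then have "ideal (\<Union>C) R"
      using chain_Union_is_ideal[of C] C(1) by simp
    then show "\<Union>C \<in> ?A"
      using C by (auto simp: pred_on.chain_def)
  qed
  then obtain I where I: "ideal I R" "J \<subseteq> I" "\<one> \<notin> I"
    and max: "\<And>K. ideal K R \<Longrightarrow> J \<subseteq> K \<Longrightarrow> \<one> \<notin> K \<Longrightarrow> I \<subseteq> K \<Longrightarrow> K = I"
    by auto
  have "maximalideal I R"
  proof (rule maximalidealI[OF I(1)])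
    show "carrier R \<noteq> I"
      using I(3) by auto
    show "K = I \<or> K = carrier R" if "ideal K R" "I \<subseteq> K" "K \<subseteq> carrier R" for K
      using max[of K] that I(2) ideal.one_imp_carrier by blast
  qed
  then show thesis
    using that I(2) by blast
qed

lemma (in cring) maximalideal_one_notin:
  assumes "maximalideal I R"
  shows "\<one> \<notin> I"
  using assms maximalideal.I_notcarr maximalideal.axioms(1) ideal.one_imp_carrier by metis

text \<open>By maximality the ideal generated by \<open>I\<close> and \<open>f\<close> is the whole
  ring, and an expression of \<open>\<one>\<close> in it contains the inverse modulo
  \<open>I\<close>.\<close>

lemma (in cring) maximalideal_inverse:
  assumes "maximalideal I R" "f \<in> carrier R" "f \<notin> I"
  obtains g where "g \<in> carrier R" "\<one> \<ominus> g \<otimes> f \<in> I"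
proof -
  interpret I: maximalideal I R by fact
  have id: "ideal (I <+>\<^bsub>R\<^esub> PIdl f) R"
    using I.is_ideal assms(2) by (intro add_ideals cgenideal_ideal) auto
  have "i \<in> I <+>\<^bsub>R\<^esub> PIdl f" if "i \<in> I" for i
  proof -
    have "i = i \<oplus> \<zero> \<otimes> f"
      using that assms(2) I.Icarr by simp
    then show ?thesis
      using that by (fastforce simp: set_add_defs cgenideal_def)
  qed
  moreover have "f \<in> I <+>\<^bsub>R\<^esub> PIdl f"
  proof -
    have "f = \<zero> \<oplus> \<one> \<otimes> f" "\<zero> \<in> I"
      using assms(2) I.zero_closed by simp_all
    then show ?thesis
      by (fastforce simp: set_add_defs cgenideal_def)
  qed
  ultimately have "I <+>\<^bsub>R\<^esub> PIdl f = carrier R"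
    using I.I_maximal[OF id] assms(3) id ideal.axioms(1) additive_subgroup.a_subset by blast
  then have "\<one> \<in> I <+>\<^bsub>R\<^esub> PIdl f"
    by simp
  then obtain i g where ig: "i \<in> I" "g \<in> carrier R" "\<one> = i \<oplus> g \<otimes> f"
    by (auto simp: set_add_defs cgenideal_def)
  then have "\<one> \<ominus> g \<otimes> f = i"
    using assms(2) I.Icarr by (simp add: a_minus_def a_assoc r_neg)
  then show thesis
    using that ig by blast
qed

lemma (in ring) carrier_FactRing_eq_image: "carrier (R Quot I) = (+>) I ` carrier R"
  by (auto simp: FactRing_def A_RCOSETS_def')

lemma (in ring) Union_image_a_r_coset:
  assumes "ideal I R" "ideal J R" "I \<subseteq> J"
  shows "\<Union> ((+>) I ` J) = J"
  using assms ideal_incl_iff[of I J] by simp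

text \<open>The union of an ideal of cosets is its preimage under the quotient map. Through this
  correspondence the maximal ideals of L^\<infinity> can be studied as ideals of functions.\<close>

lemma (in ring) ideal_FactRing:
  assumes "ideal I R" "ideal K (R Quot I)"
  shows "ideal (\<Union>K) R" "I \<subseteq> \<Union>K" "(+>) I ` \<Union>K = K"
proof -
  have "K \<in> (\<lambda>J. (+>) I ` J) ` {J. ideal J R \<and> I \<subseteq> J}"
    using quot_ideal_correspondence[OF assms(1)] assms(2) by (simp add: bij_betw_def)
  then obtain J where J: "ideal J R" "I \<subseteq> J" "K = (+>) I ` J"
    by auto
  then have "\<Union>K = J"
    using Union_image_a_r_coset[OF assms(1)] by simp
  then show "ideal (\<Union>K) R" "I \<subseteq> \<Union>K" "(+>) I ` \<Union>K = K"
    using J by auto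
qed

lemma (in ring) maximalideal_FactRing_Union:
  assumes I: "ideal I R" and K: "maximalideal K (R Quot I)"
  shows "maximalideal (\<Union>K) R"
proof -
  interpret K: maximalideal K "R Quot I" by fact
  note K' = ideal_FactRing[OF I K.is_ideal]
  show ?thesis
  proof (rule maximalidealI[OF K'(1)])
    show "carrier R \<noteq> \<Union>K"
      using K.I_notcarr K'(3) by (auto simp: carrier_FactRing_eq_image)
    fix L assume L: "ideal L R" "\<Union>K \<subseteq> L" "L \<subseteq> carrier R"
    have "(+>) I ` L = K \<or> (+>) I ` L = carrier (R Quot I)"
    proof (rule K.I_maximal)
      show "ideal ((+>) I ` L) (R Quot I)"
        by (rule ring_ideal_imp_quot_ideal[OF I L(1)])
      show "K \<subseteq> (+>) I ` L"
        using K'(3) L(2) by blast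
      show "(+>) I ` L \<subseteq> carrier (R Quot I)"
        using L(3) by (auto simp: carrier_FactRing_eq_image)
    qed
    moreover have "\<Union>((+>) I ` L) = L"
      using Union_image_a_r_coset[OF I L(1)] K'(2) L(2) by blast
    moreover have "\<Union>(carrier (R Quot I)) = carrier R"
      unfolding carrier_FactRing_eq_image
      using Union_image_a_r_coset[OF I oneideal] I additive_subgroup.a_subset ideal.axioms(1) by blast
    ultimately show "L = \<Union>K \<or> L = carrier R"
      by metis
  qed
qed

lemma (in ring) maximalideal_FactRing_image:
  assumes I: "ideal I R" and J: "maximalideal J R" "I \<subseteq> J"
  shows "maximalideal ((+>) I ` J) (R Quot I)"
proof -
  interpret J: maximalideal J R by fact
  note U = Union_image_a_r_coset[OF I J.is_ideal J(2)]
  show ?thesis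
  proof (rule maximalidealI)
    show "ideal ((+>) I ` J) (R Quot I)"
      by (rule ring_ideal_imp_quot_ideal[OF I J.is_ideal])
    have "\<Union>(carrier (R Quot I)) = carrier R"
      unfolding carrier_FactRing_eq_image
      using Union_image_a_r_coset[OF I oneideal] I additive_subgroup.a_subset ideal.axioms(1) by blast
    then show "carrier (R Quot I) \<noteq> (+>) I ` J"
      using U J.I_notcarr by metis
    fix L assume L: "ideal L (R Quot I)" "(+>) I ` J \<subseteq> L" "L \<subseteq> carrier (R Quot I)"
    note L' = ideal_FactRing[OF I L(1)]
    have "\<Union>L = J \<or> \<Union>L = carrier R"
    proof (rule J.I_maximal[OF L'(1)])
      show "J \<subseteq> \<Union>L"
        using U L(2) by blast
      show "\<Union>L \<subseteq> carrier R"
        using L'(1) additive_subgroup.a_subset ideal.axioms(1) by blast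
    qed
    then show "L = (+>) I ` J \<or> L = carrier (R Quot I)"
      using L'(3) by (auto simp: carrier_FactRing_eq_image)
  qed
qed


section \<open>Maximal ideals of the essentially bounded functions\<close>

abbreviation ess_bounded :: "'a measure \<Rightarrow> ('a \<Rightarrow> complex) set" where
  "ess_bounded M \<equiv> carrier (ess_bounded_ring M)"

lemma ess_bounded_iff:
  "f \<in> ess_bounded M \<longleftrightarrow> f \<in> borel_measurable M \<and> (\<exists>C. AE x in M. norm (f x) \<le> C)"
  by (simp add: ess_bounded_ring_def)

lemma ess_boundedI:
  "f \<in> borel_measurable M \<Longrightarrow> AE x in M. norm (f x) \<le> C \<Longrightarrow> f \<in> ess_bounded M"
  by (auto simp: ess_bounded_iff)

lemma ess_bounded_ring_simps [simp]:
  "f \<otimes>\<^bsub>ess_bounded_ring M\<^esub> g = (\<lambda>x. f x * g x)"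
  "f \<oplus>\<^bsub>ess_bounded_ring M\<^esub> g = (\<lambda>x. f x + g x)"
  "\<one>\<^bsub>ess_bounded_ring M\<^esub> = (\<lambda>x. 1)"
  "\<zero>\<^bsub>ess_bounded_ring M\<^esub> = (\<lambda>x. 0)"
  by (simp_all add: ess_bounded_ring_def)

lemma ess_bounded_ring_minus [simp]:
  assumes "g \<in> ess_bounded M"
  shows "f \<ominus>\<^bsub>ess_bounded_ring M\<^esub> g = (\<lambda>x. f x - g x)"
proof -
  interpret cring "ess_bounded_ring M"
    by (rule cring_ess_bounded_ring)
  have "(\<lambda>x. - g x) \<in> ess_bounded M"
    using assms by (auto simp: ess_bounded_iff)
  then have "\<ominus>\<^bsub>ess_bounded_ring M\<^esub> g = (\<lambda>x. - g x)"
    using assms by (intro minus_equality) auto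
  then show ?thesis
    by (simp add: a_minus_def)
qed

lemma ess_bounded_const [simp]: "(\<lambda>x. c) \<in> ess_bounded M"
  by (auto simp: ess_bounded_iff)

lemma ess_bounded_add: "f \<in> ess_bounded M \<Longrightarrow> g \<in> ess_bounded M \<Longrightarrow> (\<lambda>x. f x + g x) \<in> ess_bounded M"
  using cring.cring_simprules(1)[OF cring_ess_bounded_ring, of f M g] by simp

lemma ess_bounded_mult: "f \<in> ess_bounded M \<Longrightarrow> g \<in> ess_bounded M \<Longrightarrow> (\<lambda>x. f x * g x) \<in> ess_bounded M"
  using cring.cring_simprules(5)[OF cring_ess_bounded_ring, of f M g] by simp

lemma ess_bounded_diff: "f \<in> ess_bounded M \<Longrightarrow> g \<in> ess_bounded M \<Longrightarrow> (\<lambda>x. f x - g x) \<in> ess_bounded M"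
  using cring.cring_simprules(4)[OF cring_ess_bounded_ring, of f M g] by simp

lemma ess_bounded_indicator: "A \<in> sets M \<Longrightarrow> (indicator A :: _ \<Rightarrow> complex) \<in> ess_bounded M"
  by (intro ess_boundedI[where C = 1] borel_measurable_indicator) (auto simp: indicator_def)

text \<open>Describes the preimages, in the ring of functions, of the maximal ideals of
  L^\<infinity>. Containing the null functions is what makes membership independent of the values on
  a null set.\<close>

locale ess_bounded_maximal =
  fixes M :: "'a measure" and J :: "('a \<Rightarrow> complex) set"
  assumes maximal: "maximalideal J (ess_bounded_ring M)"
    and null_subset: "null_functions M \<subseteq> J"
begin

lemma J_ideal: "ideal J (ess_bounded_ring M)"
  using maximal by (rule maximalideal.axioms(1))

lemma J_bounded: "f \<in> J \<Longrightarrow> f \<in> ess_bounded M"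
  using J_ideal by (rule ideal.Icarr)

lemma J_add: "f \<in> J \<Longrightarrow> g \<in> J \<Longrightarrow> (\<lambda>x. f x + g x) \<in> J"
  using additive_subgroup.a_closed[OF ideal.axioms(1)[OF J_ideal], of f g] by simp

lemma J_mult: "f \<in> J \<Longrightarrow> g \<in> ess_bounded M \<Longrightarrow> (\<lambda>x. g x * f x) \<in> J"
  using ideal.I_l_closed[OF J_ideal, of f g] by simp

lemma J_diff: "f \<in> J \<Longrightarrow> g \<in> J \<Longrightarrow> (\<lambda>x. f x - g x) \<in> J"
  using J_add[of f "\<lambda>x. - g x"] J_mult[of g "\<lambda>x. - 1"] by simp

lemma one_notin_J: "(\<lambda>x. 1) \<notin> J"
  using cring.maximalideal_one_notin[OF cring_ess_bounded_ring maximal] by simp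

lemma J_AE_cong:
  assumes "f \<in> J" "g \<in> borel_measurable M" "AE x in M. f x = g x"
  shows "g \<in> J"
proof -
  have "f \<in> borel_measurable M"
    using J_bounded[OF assms(1)] by (simp add: ess_bounded_iff)
  then have "(\<lambda>x. g x - f x) \<in> null_functions M"
    using assms by (auto simp: null_functions_def)
  then show ?thesis
    using J_add[OF _ assms(1)] null_subset by fastforce
qed

lemma J_inverse:
  assumes "f \<in> ess_bounded M" "f \<notin> J"
  obtains g where "g \<in> ess_bounded M" "(\<lambda>x. 1 - g x * f x) \<in> J"
  using cring.maximalideal_inverse[OF cring_ess_bounded_ring maximal assms]
  by (auto simp: ess_bounded_mult[OF _ assms(1)])

text \<open>On \<open>A\<close> the function \<open>f\<close> has an essentially bounded reciprocal,
  so the product of \<open>f\<close> with \<open>indicator A / f\<close> stays in the ideal, and it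
  is \<open>indicator A\<close> almost everywhere. Off \<open>A\<close> the numerator is 0, whatever
  \<open>f\<close> does there.\<close>

lemma indicator_in_J:
  assumes f: "f \<in> J" and A: "A \<in> sets M" and "\<delta> > 0" and bound: "AE x in M. x \<in> A \<longrightarrow> \<delta> \<le> norm (f x)"
  shows "indicator A \<in> J"
proof -
  have [measurable]: "f \<in> borel_measurable M" "A \<in> sets M"
    using J_bounded[OF f] A by (simp_all add: ess_bounded_iff)
  let ?g = "\<lambda>x. indicator A x / f x"
  have "AE x in M. norm (?g x) \<le> 1 / \<delta>"
    using bound
  proof eventually_elim
    case (elim x)
    then show ?case
      using \<open>\<delta> > 0\<close> by (auto simp: indicator_def norm_divide frac_le)
  qed
  then have "?g \<in> ess_bounded M"
    by (intro ess_boundedI) measurable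
  then have "(\<lambda>x. ?g x * f x) \<in> J"
    by (rule J_mult[OF f])
  then show ?thesis
  proof (rule J_AE_cong)
    show "AE x in M. ?g x * f x = indicator A x"
      using bound by eventually_elim (use \<open>\<delta> > 0\<close> in \<open>auto simp: indicator_def\<close>)
  qed measurable
qed

lemma not_bounded_below:
  assumes "f \<in> J" "\<delta> > 0"
  shows "\<not> (AE x in M. \<delta> \<le> norm (f x))"
proof
  assume "AE x in M. \<delta> \<le> norm (f x)"
  then have "indicator (space M) \<in> J"
    by (intro indicator_in_J[OF assms(1) _ assms(2)]) auto
  then have "(\<lambda>x. 1) \<in> J"
    by (rule J_AE_cong) (auto intro!: AE_I2)
  then show False
    using one_notin_J by blast
qed

lemma indicator_Un_in_J:
  assumes "indicator A \<in> J" "indicator B \<in> J"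
  shows "indicator (A \<union> B) \<in> J"
proof -
  have "(\<lambda>x. (1 - indicator A x) * indicator B x) \<in> J"
    using assms J_bounded by (intro J_mult ess_bounded_diff) auto
  then have "(\<lambda>x. indicator A x + (1 - indicator A x) * indicator B x) \<in> J"
    by (rule J_add[OF assms(1)])
  moreover have "(\<lambda>x. indicator A x + (1 - indicator A x) * indicator B x) = (indicator (A \<union> B) :: _ \<Rightarrow> complex)"
    by (auto simp: indicator_def fun_eq_iff)
  ultimately show ?thesis
    by simp
qed

lemma indicator_UN_in_J:
  assumes "finite S" "\<And>s. s \<in> S \<Longrightarrow> indicator (A s) \<in> J"
  shows "indicator (\<Union>s\<in>S. A s) \<in> J"
  using assms
proof (induction S)
  case empty
  have "(\<lambda>x. 0) \<in> J"
    using additive_subgroup.zero_closed[OF ideal.axioms(1)[OF J_ideal]] by simp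
  then show ?case
    by (simp add: indicator_def fun_eq_iff)
next
  case (insert s S)
  then show ?case
    using indicator_Un_in_J[of "A s" "\<Union>s\<in>S. A s"] by simp
qed

lemma not_AE_mem_UN:
  assumes "finite S" "\<And>s. s \<in> S \<Longrightarrow> indicator (A s) \<in> J"
  shows "\<not> (AE x in M. x \<in> (\<Union>s\<in>S. A s))"
proof
  assume "AE x in M. x \<in> (\<Union>s\<in>S. A s)"
  then have "AE x in M. 1 \<le> norm (indicator (\<Union>s\<in>S. A s) x :: complex)"
    by eventually_elim auto
  then show False
    using not_bounded_below[OF indicator_UN_in_J[OF assms], where \<delta> = 1] by simp
qed

text \<open>The Gelfand--Mazur theorem: if no \<open>f - c\<close> belonged to \<open>J\<close>, a compactness argument on the
  essential range of \<open>f\<close> would put the constant \<open>1\<close> into \<open>J\<close>.\<close>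

lemma ex1_value:
  assumes f: "f \<in> ess_bounded M"
  shows "\<exists>!c. (\<lambda>x. f x - c) \<in> J"
proof (rule ex_ex1I)
  have [measurable]: "f \<in> borel_measurable M"
    using f by (simp add: ess_bounded_iff)
  obtain C where C: "AE x in M. norm (f x) \<le> C"
    using f by (auto simp: ess_bounded_iff)
  show "\<exists>c. (\<lambda>x. f x - c) \<in> J"
  proof (rule ccontr)
    assume no_value: "\<nexists>c. (\<lambda>x. f x - c) \<in> J"
    have "\<exists>r>0. indicator {x \<in> space M. f x \<in> ball c r} \<in> J" for c
    proof -
      have "(\<lambda>x. f x - c) \<in> ess_bounded M"
        using f by (intro ess_bounded_diff) auto
      then obtain g where g: "g \<in> ess_bounded M" "(\<lambda>x. 1 - g x * (f x - c)) \<in> J"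
        using J_inverse no_value by blast
      then obtain B where B: "AE x in M. norm (g x) \<le> B"
        by (auto simp: ess_bounded_iff)
      \<comment> \<open>With this radius \<open>g * (f - c)\<close> has modulus at most 1/2 wherever
        \<open>f\<close> takes values in the ball, so the member \<open>1 - g * (f - c)\<close> of
        \<open>J\<close> has modulus at least 1/2 there.\<close>
      define r where "r = 1 / (2 * (\<bar>B\<bar> + 1))"
      have "r > 0"
        by (simp add: r_def)
      have "indicator {x \<in> space M. f x \<in> ball c r} \<in> J"
      proof (rule indicator_in_J[OF g(2)])
        show "AE x in M. x \<in> {x \<in> space M. f x \<in> ball c r} \<longrightarrow> 1 / 2 \<le> norm (1 - g x * (f x - c))"
          using B
        proof eventually_elim
          case (elim x)
          show ?case
          proof
            assume "x \<in> {x \<in> space M. f x \<in> ball c r}"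
            then have "norm (f x - c) \<le> r"
              by (simp add: dist_norm norm_minus_commute)
            then have "norm (g x * (f x - c)) \<le> (\<bar>B\<bar> + 1) * r"
              unfolding norm_mult using elim by (intro mult_mono) auto
            also have "\<dots> = 1 / 2"
              by (simp add: r_def)
            finally show "1 / 2 \<le> norm (1 - g x * (f x - c))"
              using norm_triangle_ineq2[of 1 "g x * (f x - c)"] by simp
          qed
        qed
      qed simp_all
      with \<open>r > 0\<close> show ?thesis
        by blast
    qed
    then obtain r where r: "r c > 0" "indicator {x \<in> space M. f x \<in> ball c (r c)} \<in> J" for c
      by metis
    \<comment> \<open>Almost all values of \<open>f\<close> lie in this compact disc, so the
      preimages of finitely many balls cover almost the whole space.\<close>
    have "cball 0 C \<subseteq> (\<Union>c\<in>UNIV. ball c (r c))"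
      using r(1) centre_in_ball by blast
    then obtain S where S: "finite S" "cball 0 C \<subseteq> (\<Union>c\<in>S. ball c (r c))"
      using compactE_image[OF compact_cball[of "0 :: complex" C], of UNIV "\<lambda>c. ball c (r c)"] open_ball by metis
    have "AE x in M. x \<in> (\<Union>c\<in>S. {x \<in> space M. f x \<in> ball c (r c)})"
      using C AE_space
    proof eventually_elim
      case (elim x)
      then have "f x \<in> cball 0 C"
        by simp
      then show ?case
        using S(2) elim by blast
    qed
    with not_AE_mem_UN[OF S(1) r(2)] show False
      by (rule notE)
  qed
  show "c = d" if cd: "(\<lambda>x. f x - c) \<in> J" "(\<lambda>x. f x - d) \<in> J" for c d
  proof (rule ccontr)
    assume "c \<noteq> d"
    have "(\<lambda>x. (f x - c) - (f x - d)) \<in> J"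
      using cd by (rule J_diff)
    then have "(\<lambda>x. d - c) \<in> J"
      by simp
    then show False
      using not_bounded_below[of "\<lambda>x. d - c" "norm (d - c)"] \<open>c \<noteq> d\<close> by simp
  qed
qed

text \<open>The multiplicative linear functional with kernel \<open>J\<close>: reduction modulo
  \<open>J\<close>, where the residue field has just been identified with the complex
  numbers.\<close>

definition val :: "('a \<Rightarrow> complex) \<Rightarrow> complex" where
  "val f = (THE c. (\<lambda>x. f x - c) \<in> J)"

lemma val_in_J: "f \<in> ess_bounded M \<Longrightarrow> (\<lambda>x. f x - val f) \<in> J"
  unfolding val_def by (rule theI'[OF ex1_value])

lemma val_eqI: "f \<in> ess_bounded M \<Longrightarrow> (\<lambda>x. f x - c) \<in> J \<Longrightarrow> val f = c"
  using ex1_value val_in_J by blast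

lemma val_const [simp]: "val (\<lambda>x. c) = c"
proof (rule val_eqI)
  show "(\<lambda>x. c - c) \<in> J"
    using additive_subgroup.zero_closed[OF ideal.axioms(1)[OF J_ideal]] by simp
qed simp

lemma val_add:
  assumes "f \<in> ess_bounded M" "g \<in> ess_bounded M"
  shows "val (\<lambda>x. f x + g x) = val f + val g"
proof (rule val_eqI)
  show "(\<lambda>x. f x + g x - (val f + val g)) \<in> J"
    using J_add[OF val_in_J val_in_J, OF assms] by (simp add: algebra_simps)
qed (intro ess_bounded_add assms)

lemma val_mult:
  assumes "f \<in> ess_bounded M" "g \<in> ess_bounded M"
  shows "val (\<lambda>x. f x * g x) = val f * val g"
proof (rule val_eqI)
  have "(\<lambda>x. f x * (g x - val g) + val g * (f x - val f)) \<in> J"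
    using assms by (intro J_add J_mult val_in_J) auto
  then show "(\<lambda>x. f x * g x - val f * val g) \<in> J"
    by (simp add: algebra_simps)
qed (intro ess_bounded_mult assms)

lemma val_cmult: "f \<in> ess_bounded M \<Longrightarrow> val (\<lambda>x. c * f x) = c * val f"
  using val_mult[of "\<lambda>x. c" f] by simp

lemma val_diff: "f \<in> ess_bounded M \<Longrightarrow> g \<in> ess_bounded M \<Longrightarrow> val (\<lambda>x. f x - g x) = val f - val g"
  using val_add[of f "\<lambda>x. - 1 * g x"] val_cmult[of g "- 1"] ess_bounded_mult[of "\<lambda>x. - 1" M g] by simp

lemma val_AE_cong:
  assumes "f \<in> ess_bounded M" "g \<in> borel_measurable M" "AE x in M. f x = g x"
  shows "val g = val f"
proof (rule val_eqI)
  obtain C where "AE x in M. norm (f x) \<le> C"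
    using assms(1) by (auto simp: ess_bounded_iff)
  with assms(3) have "AE x in M. norm (g x) \<le> C"
    by eventually_elim simp
  with assms(2) show "g \<in> ess_bounded M"
    by (rule ess_boundedI)
  show "(\<lambda>x. g x - val f) \<in> J"
    using val_in_J[OF assms(1)] by (rule J_AE_cong) (use assms in auto)
qed

text \<open>A character takes its values in the essential range: otherwise \<open>f - val f\<close>,
  which lies in \<open>J\<close>, would be bounded away from 0.\<close>

lemma val_in_closed:
  assumes f: "f \<in> ess_bounded M" and S: "closed S" and AE: "AE x in M. f x \<in> S"
  shows "val f \<in> S"
proof (rule ccontr)
  assume "val f \<notin> S"
  then obtain \<delta> where \<delta>: "\<delta> > 0" "ball (val f) \<delta> \<subseteq> - S"
    using S by (meson ComplI open_Compl open_contains_ball)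
  have "AE x in M. \<delta> \<le> norm (f x - val f)"
    using AE
  proof eventually_elim
    case (elim x)
    then have "f x \<notin> ball (val f) \<delta>"
      using \<delta>(2) by blast
    then show ?case
      by (simp add: dist_norm norm_minus_commute)
  qed
  then show False
    using not_bounded_below[OF val_in_J[OF f] \<delta>(1)] by blast
qed

lemma norm_val_le:
  assumes "f \<in> ess_bounded M" "AE x in M. norm (f x) \<le> C"
  shows "norm (val f) \<le> C"
  using val_in_closed[OF assms(1) closed_cball[of 0 C]] assms(2) by simp

lemma val_indicator:
  assumes "A \<in> sets M"
  shows "val (indicator A) = (if indicator A \<in> J then 0 else 1)"
proof (cases "indicator A \<in> J")
  case True
  then show ?thesis
    using val_eqI[of "indicator A" 0] ess_bounded_indicator[OF assms] by simp
next
  case False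
  have "val (indicator A) \<in> {0, 1}"
    by (rule val_in_closed[OF ess_bounded_indicator[OF assms]]) (auto simp: indicator_def)
  moreover have "val (indicator A) \<noteq> 0"
    using val_in_J[OF ess_bounded_indicator[OF assms]] False by auto
  ultimately show ?thesis
    using False by simp
qed

end


section \<open>Characters and continuous functions on the maximal ideal space\<close>

abbreviation ess_class :: "'a measure \<Rightarrow> ('a \<Rightarrow> complex) \<Rightarrow> ('a \<Rightarrow> complex) set" where
  "ess_class M \<equiv> a_r_coset (ess_bounded_ring M) (null_functions M)"

lemma ess_bounded_maximal_Union:
  assumes "I \<in> maximal_ideals M"
  shows "ess_bounded_maximal M (\<Union>I)"
proof (rule ess_bounded_maximal.intro)
  interpret cring "ess_bounded_ring M"
    by (rule cring_ess_bounded_ring)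
  have I: "maximalideal I (ess_bounded_ring M Quot null_functions M)"
    using assms by (simp add: maximal_ideals_def L_infinity_def)
  show "maximalideal (\<Union>I) (ess_bounded_ring M)"
    by (rule maximalideal_FactRing_Union[OF ideal_null_functions I])
  show "null_functions M \<subseteq> \<Union>I"
    by (rule ideal_FactRing(2)[OF ideal_null_functions maximalideal.axioms(1)[OF I]])
qed

lemma image_Union_maximal_ideal:
  assumes "I \<in> maximal_ideals M"
  shows "ess_class M ` \<Union>I = I"
proof -
  interpret cring "ess_bounded_ring M"
    by (rule cring_ess_bounded_ring)
  show ?thesis
    using assms ideal_FactRing(3)[OF ideal_null_functions, OF maximalideal.axioms(1)]
    by (simp add: maximal_ideals_def L_infinity_def)
qed

lemma image_in_maximal_ideals:
  assumes "ess_bounded_maximal M J"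
  shows "ess_class M ` J \<in> maximal_ideals M"
    and "\<Union> (ess_class M ` J) = J"
proof -
  interpret cring "ess_bounded_ring M"
    by (rule cring_ess_bounded_ring)
  have J: "maximalideal J (ess_bounded_ring M)" "null_functions M \<subseteq> J"
    using assms by (simp_all add: ess_bounded_maximal_def)
  show "ess_class M ` J \<in> maximal_ideals M"
    using maximalideal_FactRing_image[OF ideal_null_functions J]
    by (simp add: maximal_ideals_def L_infinity_def)
  show "\<Union> (ess_class M ` J) = J"
    by (rule Union_image_a_r_coset[OF ideal_null_functions maximalideal.axioms(1)[OF J(1)] J(2)])
qed

abbreviation character :: "('a \<Rightarrow> complex) set set \<Rightarrow> ('a \<Rightarrow> complex) \<Rightarrow> complex" where
  "character I \<equiv> ess_bounded_maximal.val (\<Union>I)"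

lemma carrier_L_infinity: "carrier (L_infinity M) = ess_class M ` ess_bounded M"
  using ring.carrier_FactRing_eq_image[OF cring.axioms(1)[OF cring_ess_bounded_ring]]
  by (simp add: L_infinity_def)

text \<open>Both sides are the scalar that represents \<open>f\<close>, on the left modulo
  \<open>I\<close> and on the right modulo its preimage. From here on Gelfand transforms are
  computed with functions instead of cosets.\<close>

lemma gelfand_transform_ess_class:
  assumes I: "I \<in> maximal_ideals M" and f: "f \<in> ess_bounded M"
  shows "gelfand_transform M (ess_class M f) I = character I f"
proof -
  interpret cring "ess_bounded_ring M"
    by (rule cring_ess_bounded_ring)
  interpret ess_bounded_maximal M "\<Union>I"
    by (rule ess_bounded_maximal_Union[OF I])
  interpret N: ideal "null_functions M" "ess_bounded_ring M"
    by (rule ideal_null_functions)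
  interpret hom: ring_hom_ring "ess_bounded_ring M" "L_infinity M" "ess_class M"
    using N.rcos_ring_hom_ring by (simp add: L_infinity_def)
  have sub: "I \<subseteq> carrier (L_infinity M)"
    using I by (simp add: maximal_ideals_def additive_subgroup.a_subset ideal.axioms(1) maximalideal.axioms(1))
  have "ess_class M f \<ominus>\<^bsub>L_infinity M\<^esub> L_infinity_const M c \<in> I \<longleftrightarrow> (\<lambda>x. f x - c) \<in> \<Union>I" for c
  proof -
    have "ess_class M f \<ominus>\<^bsub>L_infinity M\<^esub> L_infinity_const M c
        = ess_class M f \<oplus>\<^bsub>L_infinity M\<^esub> ess_class M (\<ominus>\<^bsub>ess_bounded_ring M\<^esub> (\<lambda>x. c))"
      unfolding L_infinity_const_def a_minus_def by (subst hom.hom_a_inv) (rule ess_bounded_const refl)+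
    also have "\<dots> = ess_class M (f \<ominus>\<^bsub>ess_bounded_ring M\<^esub> (\<lambda>x. c))"
      unfolding a_minus_def by (intro hom.hom_add[symmetric] f a_inv_closed ess_bounded_const)
    also have "f \<ominus>\<^bsub>ess_bounded_ring M\<^esub> (\<lambda>x. c) = (\<lambda>x. f x - c)"
      by simp
    finally show ?thesis
      using canonical_proj_vimage_mem_iff[OF ideal_null_functions, of I "\<lambda>x. f x - c"] sub f
      by (simp add: L_infinity_def ess_bounded_diff)
  qed
  then show ?thesis
    by (simp add: gelfand_transform_def val_def)
qed

text \<open>The functions that vanish almost everywhere outside a finite union of members of
  \<open>\<E>\<close> form an ideal, proper by \<open>no_cover\<close>; any maximal ideal above it
  serves. Read in contrapositive form, this extracts finite covers, as compactness of the maximal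
  ideal space would.\<close>

lemma ex_maximal_ideal_containing_indicators:
  assumes \<E>: "\<E> \<subseteq> sets M"
    and no_cover: "\<And>\<F>. finite \<F> \<Longrightarrow> \<F> \<subseteq> \<E> \<Longrightarrow> \<not> (AE x in M. x \<in> \<Union>\<F>)"
  obtains I where "I \<in> maximal_ideals M" "\<And>E. E \<in> \<E> \<Longrightarrow> indicator E \<in> \<Union>I"
proof -
  interpret cring "ess_bounded_ring M"
    by (rule cring_ess_bounded_ring)
  define K where "K = {f \<in> ess_bounded M. \<exists>\<F>. finite \<F> \<and> \<F> \<subseteq> \<E> \<and> (AE x in M. x \<notin> \<Union>\<F> \<longrightarrow> f x = 0)}"
  have K_I: "f \<in> K" if "f \<in> ess_bounded M" "finite \<F>" "\<F> \<subseteq> \<E>" "AE x in M. x \<notin> \<Union>\<F> \<longrightarrow> f x = 0" for f \<F>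
    using that by (auto simp: K_def)
  have K_mult: "(\<lambda>x. g x * f x) \<in> K" if fg: "f \<in> K" "g \<in> ess_bounded M" for f g
  proof -
    from fg obtain \<F> where \<F>: "finite \<F>" "\<F> \<subseteq> \<E>" "AE x in M. x \<notin> \<Union>\<F> \<longrightarrow> f x = 0"
      by (auto simp: K_def)
    show ?thesis
      by (rule K_I[OF _ \<F>(1,2)]) (use \<F>(3) fg in \<open>auto simp: K_def ess_bounded_mult\<close>)
  qed
  have K_add: "(\<lambda>x. f x + g x) \<in> K" if fg: "f \<in> K" "g \<in> K" for f g
  proof -
    from fg obtain \<F> \<G> where \<F>: "finite \<F>" "\<F> \<subseteq> \<E>" "AE x in M. x \<notin> \<Union>\<F> \<longrightarrow> f x = 0"
      and \<G>: "finite \<G>" "\<G> \<subseteq> \<E>" "AE x in M. x \<notin> \<Union>\<G> \<longrightarrow> g x = 0"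
      by (auto simp: K_def)
    have "AE x in M. x \<notin> \<Union>(\<F> \<union> \<G>) \<longrightarrow> f x + g x = 0"
      using \<F>(3) \<G>(3) by eventually_elim auto
    then show ?thesis
      by (intro K_I[of _ "\<F> \<union> \<G>"]) (use \<F> \<G> fg in \<open>auto simp: K_def ess_bounded_add\<close>)
  qed
  have null: "f \<in> K" if "f \<in> null_functions M" for f
  proof (rule K_I[of _ "{}"])
    show "f \<in> ess_bounded M"
      using that by (intro ess_boundedI[where C = 0]) (auto simp: null_functions_def)
  qed (use that in \<open>auto simp: null_functions_def\<close>)
  have "ideal K (ess_bounded_ring M)"
  proof (rule idealI)
    show "subgroup K (add_monoid (ess_bounded_ring M))"
    proof (rule group.subgroupI)
      show "group (add_monoid (ess_bounded_ring M))"
        by (rule a_group)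
      show "K \<subseteq> carrier (add_monoid (ess_bounded_ring M))"
        by (auto simp: K_def)
      have "(\<lambda>x. 0) \<in> K"
        by (rule null) (simp add: null_functions_def)
      then show "K \<noteq> {}"
        by blast
      show "inv\<^bsub>add_monoid (ess_bounded_ring M)\<^esub> f \<in> K" if "f \<in> K" for f
      proof -
        have f: "(\<lambda>x. - f x) \<in> K"
          using K_mult[OF that, of "\<lambda>x. - 1"] by simp
        then have "\<ominus>\<^bsub>ess_bounded_ring M\<^esub> f = (\<lambda>x. - f x)"
          using that by (intro minus_equality) (auto simp: K_def)
        with f show ?thesis
          by (simp add: a_inv_def)
      qed
      show "f \<otimes>\<^bsub>add_monoid (ess_bounded_ring M)\<^esub> g \<in> K" if "f \<in> K" "g \<in> K" for f g
        using K_add[OF that] by simp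
    qed
    fix f g assume "f \<in> K" "g \<in> ess_bounded M"
    then show "g \<otimes>\<^bsub>ess_bounded_ring M\<^esub> f \<in> K" "f \<otimes>\<^bsub>ess_bounded_ring M\<^esub> g \<in> K"
      using K_mult by (simp_all add: mult.commute)
  qed (rule ring_axioms)
  moreover have "\<one>\<^bsub>ess_bounded_ring M\<^esub> \<notin> K"
    using no_cover by (auto simp: K_def)
  ultimately obtain J where J: "maximalideal J (ess_bounded_ring M)" "K \<subseteq> J"
    by (rule ex_maximalideal)
  have "ess_bounded_maximal M J"
    using J null by (auto simp: ess_bounded_maximal_def)
  note image = image_in_maximal_ideals[OF this]
  have "indicator E \<in> K" if "E \<in> \<E>" for E
    by (rule K_I[of _ "{E}"]) (use that \<E> in \<open>auto simp: ess_bounded_indicator\<close>)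
  then show thesis
    using that[OF image(1)] J(2) unfolding image(2) by blast
qed

text \<open>Suppose that \<open>f\<close> has modulus at least \<open>C + \<delta>\<close> on a set
  that is not null, with complement \<open>A\<close>. Some maximal ideal contains
  \<open>indicator A\<close>, and its character does not see \<open>A\<close>. Replacing
  \<open>f\<close> on \<open>A\<close> by the constant \<open>C + \<delta>\<close> therefore leaves
  the character unchanged, although the new function has modulus at least
  \<open>C + \<delta>\<close> everywhere; so the character does too.\<close>

lemma AE_norm_le_if_characters_le:
  assumes f: "f \<in> ess_bounded M"
    and le: "\<And>I. I \<in> maximal_ideals M \<Longrightarrow> norm (character I f) \<le> C"
  shows "AE x in M. norm (f x) \<le> C"
proof -
  have [measurable]: "f \<in> borel_measurable M"
    using f by (simp add: ess_bounded_iff)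
  have "AE x in M. norm (f x) < C + \<delta>" if "\<delta> > 0" for \<delta>
  proof (rule ccontr)
    assume *: "\<not> (AE x in M. norm (f x) < C + \<delta>)"
    define A where "A = {x \<in> space M. norm (f x) < C + \<delta>}"
    have A [measurable]: "A \<in> sets M"
      unfolding A_def by measurable
    have not_AE_A: "\<not> (AE x in M. x \<in> A)"
      using * by (auto simp: A_def)
    have no_cover: "\<not> (AE x in M. x \<in> \<Union>\<F>)" if "\<F> \<subseteq> {A}" for \<F>
    proof
      assume "AE x in M. x \<in> \<Union>\<F>"
      then have "AE x in M. x \<in> A"
        by eventually_elim (use that in auto)
      then show False
        using not_AE_A by simp
    qed
    obtain I where I: "I \<in> maximal_ideals M" "indicator A \<in> \<Union>I"
    proof (rule ex_maximal_ideal_containing_indicators[of "{A}" M])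
      show "\<not> (AE x in M. x \<in> \<Union>\<F>)" if "\<F> \<subseteq> {A}" for \<F>
        by (rule no_cover[OF that])
    qed (use A in simp_all)
    interpret ess_bounded_maximal M "\<Union>I"
      by (rule ess_bounded_maximal_Union[OF I(1)])
    let ?g = "\<lambda>x. indicator A x * (of_real (C + \<delta>) - f x) + f x"
    have bounded: "indicator A \<in> ess_bounded M" "(\<lambda>x. of_real (C + \<delta>) - f x) \<in> ess_bounded M"
      by (intro ess_bounded_indicator A, intro ess_bounded_diff f) simp
    have C0: "0 \<le> C"
      using le[OF I(1)] norm_ge_zero order_trans by blast
    have "val ?g \<in> - ball 0 (C + \<delta>)"
    proof (rule val_in_closed)
      show "?g \<in> ess_bounded M"
        by (intro ess_bounded_add ess_bounded_mult bounded f)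
      show "AE x in M. ?g x \<in> - ball 0 (C + \<delta>)"
        using AE_space by eventually_elim (use C0 \<open>\<delta> > 0\<close> in \<open>auto simp: A_def indicator_def norm_of_real simp flip: of_real_add\<close>)
    qed (simp add: closed_Compl)
    moreover have "val ?g = val f"
    proof -
      have "val (indicator A) = 0"
        using I(2) by (simp add: val_indicator[OF A])
      then show ?thesis
        by (simp only: val_add[OF ess_bounded_mult[OF bounded] f] val_mult[OF bounded]) simp
    qed
    ultimately show False
      using le[OF I(1)] \<open>\<delta> > 0\<close> by simp
  qed
  then have "AE x in M. \<forall>n. norm (f x) < C + 1 / Suc n"
    by (simp add: AE_all_countable)
  then show ?thesis
  proof eventually_elim
    case (elim x)
    have "norm (f x) \<le> C + \<epsilon>" if \<epsilon>: "\<epsilon> > 0" for \<epsilon>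
    proof -
      obtain n where "1 / Suc n < \<epsilon>"
        using nat_approx_posE[OF \<epsilon>] by metis
      then show ?thesis
        using elim[rule_format, of n] by linarith
    qed
    then show ?case
      by (rule field_le_epsilon)
  qed
qed

section \<open>A base of the Gelfand topology and the representation of continuous functions\<close>

definition basic_clopen :: "'a measure \<Rightarrow> 'a set \<Rightarrow> ('a \<Rightarrow> complex) set set set" where
  "basic_clopen M A = {I \<in> maximal_ideals M. indicator A \<notin> \<Union>I}"

lemma basic_clopen_Int:
  assumes "A \<in> sets M" "B \<in> sets M"
  shows "basic_clopen M (A \<inter> B) = basic_clopen M A \<inter> basic_clopen M B"
proof -
  have "indicator (A \<inter> B) \<in> \<Union>I \<longleftrightarrow> indicator A \<in> \<Union>I \<or> indicator B \<in> \<Union>I" if "I \<in> maximal_ideals M" for I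
  proof -
    interpret ess_bounded_maximal M "\<Union>I"
      by (rule ess_bounded_maximal_Union[OF that])
    have "val (\<lambda>x. indicator A x * indicator B x) = val (indicator A) * val (indicator B)"
      by (intro val_mult ess_bounded_indicator assms)
    then show ?thesis
      using val_indicator[of "A \<inter> B"] val_indicator[of A] val_indicator[of B] assms
      by (auto simp flip: indicator_inter_arith split: if_splits)
  qed
  then show ?thesis
    unfolding basic_clopen_def by blast
qed

text \<open>For a subbasic set given by \<open>f\<close>, with \<open>c\<close> the value at
  \<open>I\<close>, take \<open>A\<close> to be the set where \<open>f\<close> is within \<delta> of
  \<open>c\<close>. Off \<open>A\<close> the member \<open>f - c\<close> of the preimage of
  \<open>I\<close> is bounded below, so the complement of \<open>A\<close> has its indicator there
  and \<open>A\<close> does not. For other ideals in the basic set the character of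
  \<open>f - c\<close> equals that of its restriction to \<open>A\<close>, hence is at most \<delta>
  in modulus; a closed ball is chosen because only \<le> survives.\<close>

lemma basic_clopen_base:
  assumes "openin (maximal_ideal_space M) U" "I \<in> U"
  shows "\<exists>A\<in>sets M. I \<in> basic_clopen M A \<and> basic_clopen M A \<subseteq> U"
proof -
  let ?S = "{{I \<in> maximal_ideals M. gelfand_transform M F I \<in> U} | F U.
        F \<in> carrier (L_infinity M) \<and> open U}"
  have "generate_topology_on ?S U"
    using assms(1) unfolding maximal_ideal_space_def openin_topology_generated_by_iff .
  then show ?thesis
    using assms(2)
  proof (induction rule: generate_topology_on.induct)
    case (Int U V)
    then obtain A B where "A \<in> sets M" "I \<in> basic_clopen M A" "basic_clopen M A \<subseteq> U"
        "B \<in> sets M" "I \<in> basic_clopen M B" "basic_clopen M B \<subseteq> V"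
      by blast
    then show ?case
      by (intro bexI[of _ "A \<inter> B"]) (auto simp: basic_clopen_Int)
  next
    case (Basis V)
    then obtain f W where f: "f \<in> ess_bounded M" and W: "open W"
      and V: "V = {I \<in> maximal_ideals M. character I f \<in> W}"
      by (auto simp: carrier_L_infinity gelfand_transform_ess_class cong: conj_cong)
    have [measurable]: "f \<in> borel_measurable M"
      using f by (simp add: ess_bounded_iff)
    define c where "c = character I f"
    have I: "I \<in> maximal_ideals M" "c \<in> W"
      using Basis V by (auto simp: c_def)
    then obtain \<delta> where \<delta>: "\<delta> > 0" "cball c \<delta> \<subseteq> W"
      using W open_contains_cball by blast
    define A where "A = {x \<in> space M. norm (f x - c) < \<delta>}"
    have A [measurable]: "A \<in> sets M"
      unfolding A_def by measurable
    have "I \<in> basic_clopen M A"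
    proof -
      interpret ess_bounded_maximal M "\<Union>I"
        by (rule ess_bounded_maximal_Union[OF I(1)])
      have "indicator (space M - A) \<in> \<Union>I"
        using indicator_in_J[OF val_in_J[OF f], of "space M - A" \<delta>] \<delta>(1)
        by (auto simp: A_def c_def)
      then have "indicator A \<notin> \<Union>I"
        using not_AE_mem_UN[of "{A, space M - A}" "\<lambda>A. A"] by auto
      then show ?thesis
        using I(1) by (simp add: basic_clopen_def)
    qed
    moreover have "character K f \<in> W" if K: "K \<in> basic_clopen M A" for K
    proof -
      have K': "K \<in> maximal_ideals M" "indicator A \<notin> \<Union>K"
        using K by (auto simp: basic_clopen_def)
      interpret ess_bounded_maximal M "\<Union>K"
        by (rule ess_bounded_maximal_Union[OF K'(1)])
      have bounded: "indicator A \<in> ess_bounded M" "(\<lambda>x. f x - c) \<in> ess_bounded M"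
        by (intro ess_bounded_indicator A, intro ess_bounded_diff f) simp
      have "val f - c = val (\<lambda>x. indicator A x * (f x - c))"
        using K'(2) by (simp add: val_mult[OF bounded] val_indicator[OF A] val_diff[OF f])
      moreover have "norm (val (\<lambda>x. indicator A x * (f x - c))) \<le> \<delta>"
        by (rule norm_val_le[OF ess_bounded_mult[OF bounded]])
          (use \<delta>(1) in \<open>auto simp: A_def indicator_def\<close>)
      ultimately have "val f \<in> cball c \<delta>"
        by (metis dist_commute dist_norm mem_cball)
      then show ?thesis
        using \<delta>(2) by blast
    qed
    ultimately show ?case
      using V A by (auto simp: basic_clopen_def)
  next
    case (UN K)
    then obtain k where "k \<in> K" "I \<in> k"
      by blast
    then show ?case
      using UN.IH Union_upper[of k K] subset_trans by metis
  qed simp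
qed

text \<open>Overwrite the function by a suitable constant on one set after the other. A character is
  0 or 1 at \<open>indicator A\<close>, so overwriting on \<open>A\<close> sets the new constant on
  \<open>basic_clopen M A\<close> and changes nothing elsewhere; overlaps of the sets are
  harmless.\<close>

lemma simple_function_on_cover:
  fixes h :: "('a \<Rightarrow> complex) set set \<Rightarrow> real"
  assumes "finite \<F>"
    and "\<And>A. A \<in> \<F> \<Longrightarrow> A \<in> sets M \<and> (\<exists>c. \<forall>I\<in>basic_clopen M A. \<bar>h I - c\<bar> \<le> \<epsilon>)"
  shows "\<exists>s :: 'a \<Rightarrow> real. (\<lambda>x. of_real (s x)) \<in> ess_bounded M \<and>
    (\<forall>A\<in>\<F>. \<forall>I\<in>basic_clopen M A. norm (character I (\<lambda>x. of_real (s x)) - of_real (h I)) \<le> \<epsilon>)"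
  using assms
proof (induction \<F>)
  case empty
  show ?case
    by (intro exI[of _ "\<lambda>x. 0"]) simp
next
  case (insert A \<F>)
  then obtain s :: "'a \<Rightarrow> real" where s: "(\<lambda>x. of_real (s x)) \<in> ess_bounded M"
    and s_close: "\<And>B I. B \<in> \<F> \<Longrightarrow> I \<in> basic_clopen M B \<Longrightarrow>
      norm (character I (\<lambda>x. of_real (s x)) - of_real (h I)) \<le> \<epsilon>"
    by auto
  from insert.prems[of A] obtain c where A: "A \<in> sets M"
    and c: "\<And>I. I \<in> basic_clopen M A \<Longrightarrow> \<bar>h I - c\<bar> \<le> \<epsilon>"
    by auto
  define t where "t x = (if x \<in> A then c else s x)" for x
  have t_eq: "(\<lambda>x. complex_of_real (t x)) = (\<lambda>x. indicator A x * (of_real c - of_real (s x)) + of_real (s x))"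
    by (auto simp: t_def fun_eq_iff)
  have bounded: "indicator A \<in> ess_bounded M" "(\<lambda>x. of_real c - of_real (s x)) \<in> ess_bounded M"
    by (intro ess_bounded_indicator A, intro ess_bounded_diff s) simp
  have t: "(\<lambda>x. of_real (t x)) \<in> ess_bounded M"
    unfolding t_eq by (intro ess_bounded_add ess_bounded_mult bounded s)
  have "norm (character I (\<lambda>x. of_real (t x)) - of_real (h I)) \<le> \<epsilon>"
    if B: "B \<in> insert A \<F>" "I \<in> basic_clopen M B" for B I
  proof -
    have I: "I \<in> maximal_ideals M"
      using B(2) by (simp add: basic_clopen_def)
    interpret ess_bounded_maximal M "\<Union>I"
      by (rule ess_bounded_maximal_Union[OF I])
    have eq: "val (\<lambda>x. of_real (t x))
        = val (indicator A) * (of_real c - val (\<lambda>x. of_real (s x))) + val (\<lambda>x. of_real (s x))"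
      unfolding t_eq val_add[OF ess_bounded_mult[OF bounded] s] val_mult[OF bounded]
        val_diff[OF ess_bounded_const s] val_const ..
    show ?thesis
    proof (cases "I \<in> basic_clopen M A")
      case True
      then have "val (indicator A) = 1"
        by (simp add: val_indicator[OF A] basic_clopen_def)
      then have "val (\<lambda>x. of_real (t x)) - of_real (h I) = of_real (c - h I)"
        unfolding eq by simp
      then show ?thesis
        using c[OF True] by (simp only: norm_of_real abs_minus_commute)
    next
      case False
      then have "val (indicator A) = 0"
        using I by (simp add: val_indicator[OF A] basic_clopen_def)
      then have "val (\<lambda>x. of_real (t x)) = val (\<lambda>x. of_real (s x))"
        unfolding eq by simp
      then show ?thesis
        using s_close B False by auto
    qed
  qed
  with t show ?case
    by blast
qed

lemma simple_approximation:
  fixes h :: "('a \<Rightarrow> complex) set set \<Rightarrow> real"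
  assumes h: "continuous_map (maximal_ideal_space M) euclidean h" and "\<epsilon> > 0"
  shows "\<exists>s :: 'a \<Rightarrow> real. (\<lambda>x. of_real (s x)) \<in> ess_bounded M \<and>
    (\<forall>I\<in>maximal_ideals M. norm (character I (\<lambda>x. of_real (s x)) - of_real (h I)) \<le> \<epsilon>)"
proof -
  define \<E> where "\<E> = {A \<in> sets M. \<exists>c. \<forall>I\<in>basic_clopen M A. \<bar>h I - c\<bar> \<le> \<epsilon>}"
  have "\<exists>\<F>. finite \<F> \<and> \<F> \<subseteq> \<E> \<and> (AE x in M. x \<in> \<Union>\<F>)"
  proof (rule ccontr)
    assume no_cover: "\<nexists>\<F>. finite \<F> \<and> \<F> \<subseteq> \<E> \<and> (AE x in M. x \<in> \<Union>\<F>)"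
    obtain I where I: "I \<in> maximal_ideals M" "\<And>A. A \<in> \<E> \<Longrightarrow> indicator A \<in> \<Union>I"
    proof (rule ex_maximal_ideal_containing_indicators)
      show "\<E> \<subseteq> sets M"
        by (auto simp: \<E>_def)
    qed (use no_cover in auto)
    let ?U = "{K \<in> topspace (maximal_ideal_space M). h K \<in> ball (h I) \<epsilon>}"
    have "openin (maximal_ideal_space M) ?U"
      using h open_ball[of "h I" \<epsilon>] unfolding continuous_map_def open_openin[symmetric] by blast
    moreover have "I \<in> ?U"
      using I(1) \<open>\<epsilon> > 0\<close> by (simp add: topspace_maximal_ideal_space)
    ultimately have "\<exists>A\<in>sets M. I \<in> basic_clopen M A \<and> basic_clopen M A \<subseteq> ?U"
      by (rule basic_clopen_base)
    then obtain A where A: "A \<in> sets M" "I \<in> basic_clopen M A" "basic_clopen M A \<subseteq> ?U"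
      by blast
    have "\<bar>h K - h I\<bar> \<le> \<epsilon>" if "K \<in> basic_clopen M A" for K
      using that A(3) by (auto simp: dist_real_def abs_minus_commute)
    then have "A \<in> \<E>"
      using A(1) by (auto simp: \<E>_def)
    then show False
      using I(2) A(2) by (auto simp: basic_clopen_def)
  qed
  then obtain \<F> where \<F>: "finite \<F>" "\<F> \<subseteq> \<E>" and AE: "AE x in M. x \<in> \<Union>\<F>"
    by blast
  \<comment> \<open>A cover of almost all of the measure space becomes a cover of the whole maximal
    ideal space, since no maximal ideal contains the indicators of finitely many sets that cover
    almost everything.\<close>
  have cover: "\<exists>A\<in>\<F>. I \<in> basic_clopen M A" if I: "I \<in> maximal_ideals M" for I
  proof (rule ccontr)
    assume none: "\<not> (\<exists>A\<in>\<F>. I \<in> basic_clopen M A)"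
    interpret ess_bounded_maximal M "\<Union>I"
      by (rule ess_bounded_maximal_Union[OF I])
    have "indicator A \<in> \<Union>I" if "A \<in> \<F>" for A
      using none that I unfolding basic_clopen_def by blast
    from not_AE_mem_UN[OF \<F>(1) this] AE show False
      by simp
  qed
  obtain s :: "'a \<Rightarrow> real" where s: "(\<lambda>x. of_real (s x)) \<in> ess_bounded M"
    "\<forall>A\<in>\<F>. \<forall>I\<in>basic_clopen M A. norm (character I (\<lambda>x. of_real (s x)) - of_real (h I)) \<le> \<epsilon>"
    using simple_function_on_cover[OF \<F>(1), of M h \<epsilon>] \<F>(2) by (auto simp: \<E>_def)
  show ?thesis
  proof (intro exI[of _ s] conjI ballI)
    fix I assume "I \<in> maximal_ideals M"
    then obtain A where "A \<in> \<F>" "I \<in> basic_clopen M A"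
      using cover by blast
    then show "norm (character I (\<lambda>x. of_real (s x)) - of_real (h I)) \<le> \<epsilon>"
      using s(2) by blast
  qed (rule s(1))
qed

text \<open>Surjectivity of the Gelfand transform, for real functions. The characters control the
  essential supremum, so functions whose transforms converge uniformly to \<open>h\<close> form a
  Cauchy sequence almost everywhere, and their limit represents \<open>h\<close>.\<close>

lemma ex_representative:
  fixes h :: "('a \<Rightarrow> complex) set set \<Rightarrow> real"
  assumes h: "continuous_map (maximal_ideal_space M) euclidean h"
  shows "\<exists>f :: 'a \<Rightarrow> real. (\<lambda>x. of_real (f x)) \<in> ess_bounded M \<and>
    (\<forall>I\<in>maximal_ideals M. character I (\<lambda>x. of_real (f x)) = of_real (h I))"
proof -
  define \<epsilon> :: "nat \<Rightarrow> real" where "\<epsilon> n = inverse (of_nat (Suc n))" for n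
  have \<epsilon>_pos: "\<epsilon> n > 0" for n
    by (simp add: \<epsilon>_def)
  have \<epsilon>_lim: "\<epsilon> \<longlonglongrightarrow> 0"
    unfolding \<epsilon>_def by (rule LIMSEQ_inverse_real_of_nat)
  have "\<forall>n. \<exists>s :: 'a \<Rightarrow> real. (\<lambda>x. of_real (s x)) \<in> ess_bounded M \<and>
    (\<forall>I\<in>maximal_ideals M. norm (character I (\<lambda>x. of_real (s x)) - of_real (h I)) \<le> \<epsilon> n)"
    using simple_approximation[OF h \<epsilon>_pos] by blast
  then obtain s :: "nat \<Rightarrow> 'a \<Rightarrow> real" where s: "\<And>n. (\<lambda>x. of_real (s n x)) \<in> ess_bounded M"
    and s_close: "\<And>n I. I \<in> maximal_ideals M \<Longrightarrow>
      norm (character I (\<lambda>x. of_real (s n x)) - of_real (h I)) \<le> \<epsilon> n"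
    by metis
  have [measurable]: "s n \<in> borel_measurable M" for n
  proof -
    have "(\<lambda>x. Re (of_real (s n x))) \<in> borel_measurable M"
      using s[of n] by (intro measurable_compose[OF _ borel_measurable_Re]) (simp add: ess_bounded_iff)
    then show ?thesis
      by simp
  qed
  have "AE x in M. norm (complex_of_real (s m x) - of_real (s n x)) \<le> \<epsilon> m + \<epsilon> n" for m n
  proof (rule AE_norm_le_if_characters_le)
    fix I assume I: "I \<in> maximal_ideals M"
    interpret ess_bounded_maximal M "\<Union>I"
      by (rule ess_bounded_maximal_Union[OF I])
    have "norm (val (\<lambda>x. of_real (s m x)) - val (\<lambda>x. of_real (s n x))) \<le> \<epsilon> m + \<epsilon> n"
      using s_close[OF I, of m] s_close[OF I, of n]
      by (rule norm_diff_triangle_le[OF _ norm_minus_commute[THEN ord_eq_le_trans]])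
    then show "norm (val (\<lambda>x. of_real (s m x) - of_real (s n x))) \<le> \<epsilon> m + \<epsilon> n"
      by (simp only: val_diff[OF s s])
  qed (intro ess_bounded_diff s)
  then have AE_close: "AE x in M. \<forall>m n. \<bar>s m x - s n x\<bar> \<le> \<epsilon> m + \<epsilon> n"
    by (simp only: AE_all_countable norm_of_real flip: of_real_diff) simp
  \<comment> \<open>By \<open>AE_close\<close>, which puts the countably many estimates into one
    exceptional set, the sequence converges almost everywhere; elsewhere \<open>lim\<close> may be a
    meaningless default value.\<close>
  define f where "f x = lim (\<lambda>n. s n x)" for x
  have f_meas [measurable]: "f \<in> borel_measurable M"
    unfolding f_def by measurable
  have AE_f: "AE x in M. \<forall>n. \<bar>f x - s n x\<bar> \<le> \<epsilon> n"
    using AE_close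
  proof eventually_elim
    case (elim x)
    have "Cauchy (\<lambda>n. s n x)"
    proof (rule metric_CauchyI)
      fix e :: real assume "e > 0"
      then have "\<forall>\<^sub>F n in sequentially. \<epsilon> n < e / 2"
        by (intro order_tendstoD[OF \<epsilon>_lim]) simp
      then obtain K where K: "\<epsilon> n < e / 2" if "n \<ge> K" for n
        by (auto simp: eventually_sequentially)
      have "dist (s m x) (s n x) < e" if "m \<ge> K" "n \<ge> K" for m n
        using elim[rule_format, of m n] K[OF that(1)] K[OF that(2)] by (simp add: dist_real_def)
      then show "\<exists>K. \<forall>m\<ge>K. \<forall>n\<ge>K. dist (s m x) (s n x) < e"
        by blast
    qed
    then have lim: "(\<lambda>n. s n x) \<longlonglongrightarrow> f x"
      unfolding f_def by (simp add: Cauchy_convergent_iff convergent_LIMSEQ_iff)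
    show ?case
    proof
      fix n
      have "(\<lambda>m. \<bar>s m x - s n x\<bar>) \<longlonglongrightarrow> \<bar>f x - s n x\<bar>"
        by (intro tendsto_intros lim)
      moreover have "(\<lambda>m. \<epsilon> m + \<epsilon> n) \<longlonglongrightarrow> 0 + \<epsilon> n"
        by (intro tendsto_intros \<epsilon>_lim)
      ultimately have "\<bar>f x - s n x\<bar> \<le> 0 + \<epsilon> n"
        by (rule LIMSEQ_le) (use elim in blast)
      then show "\<bar>f x - s n x\<bar> \<le> \<epsilon> n"
        by simp
    qed
  qed
  obtain C where C: "AE x in M. norm (complex_of_real (s 0 x)) \<le> C"
    using s[of 0] by (auto simp: ess_bounded_iff)
  have f: "(\<lambda>x. complex_of_real (f x)) \<in> ess_bounded M"
  proof (rule ess_boundedI)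
    show "AE x in M. norm (complex_of_real (f x)) \<le> \<epsilon> 0 + C"
      using AE_f C
    proof eventually_elim
      case (elim x)
      show ?case
        using spec[OF elim(1), of 0] elim(2) unfolding norm_of_real by linarith
    qed
  qed measurable
  have "character I (\<lambda>x. of_real (f x)) = of_real (h I)" if I: "I \<in> maximal_ideals M" for I
  proof -
    interpret ess_bounded_maximal M "\<Union>I"
      by (rule ess_bounded_maximal_Union[OF I])
    let ?d = "norm (val (\<lambda>x. of_real (f x)) - of_real (h I))"
    have "?d \<le> \<epsilon> n + \<epsilon> n" for n
    proof (rule norm_diff_triangle_le[OF _ s_close[OF I]])
      have "norm (val (\<lambda>x. of_real (f x) - of_real (s n x))) \<le> \<epsilon> n"
      proof (rule norm_val_le[OF ess_bounded_diff[OF f s]])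
        show "AE x in M. norm (complex_of_real (f x) - of_real (s n x)) \<le> \<epsilon> n"
          using AE_f by eventually_elim (simp only: norm_of_real flip: of_real_diff)
      qed
      then show "norm (val (\<lambda>x. of_real (f x)) - val (\<lambda>x. of_real (s n x))) \<le> \<epsilon> n"
        by (simp only: val_diff[OF f s])
    qed
    then have le: "\<exists>k. \<forall>n\<ge>k. ?d \<le> \<epsilon> n + \<epsilon> n"
      by blast
    have "(\<lambda>n. \<epsilon> n + \<epsilon> n) \<longlonglongrightarrow> 0 + 0"
      by (intro tendsto_intros \<epsilon>_lim)
    from LIMSEQ_le_const[OF this le] show ?thesis
      by simp
  qed
  with f show ?thesis
    by blast
qed


section \<open>Composition with a nonsingular automorphism\<close>

text \<open>Respecting null sets is what makes composition well defined on classes in L^\<infinity>.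
  The maps are mutually inverse on the whole type, because the functions composed with them are
  total.\<close>

locale nonsingular_automorphism =
  fixes M :: "'a measure" and r s :: "'a \<Rightarrow> 'a"
  assumes r_measurable [measurable]: "r \<in> M \<rightarrow>\<^sub>M M" and s_measurable [measurable]: "s \<in> M \<rightarrow>\<^sub>M M"
    and r_s [simp]: "r (s x) = x" and s_r [simp]: "s (r x) = x"
    and r_null: "N \<in> null_sets M \<Longrightarrow> r -` N \<inter> space M \<in> null_sets M"
    and s_null: "N \<in> null_sets M \<Longrightarrow> s -` N \<inter> space M \<in> null_sets M"
begin

lemma swap: "nonsingular_automorphism M s r"
  by unfold_locales (simp_all add: r_null s_null)

lemma AE_r:
  assumes "AE x in M. P x"
  shows "AE x in M. P (r x)"
proof -
  from assms obtain N where N: "{x \<in> space M. \<not> P x} \<subseteq> N" "N \<in> null_sets M"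
    by (auto elim!: AE_E simp: null_sets_def)
  have "{x \<in> space M. \<not> P (r x)} \<subseteq> r -` N \<inter> space M"
    using N(1) measurable_space[OF r_measurable] by auto
  then show ?thesis
    by (rule AE_I'[OF r_null[OF N(2)]])
qed

lemma ess_bounded_r:
  assumes "f \<in> ess_bounded M"
  shows "(\<lambda>x. f (r x)) \<in> ess_bounded M"
proof -
  obtain C where [measurable]: "f \<in> borel_measurable M" and C: "AE x in M. norm (f x) \<le> C"
    using assms by (auto simp: ess_bounded_iff)
  show ?thesis
    by (rule ess_boundedI[OF _ AE_r[OF C]]) measurable
qed

lemma ess_bounded_s: "f \<in> ess_bounded M \<Longrightarrow> (\<lambda>x. f (s x)) \<in> ess_bounded M"
  by (rule nonsingular_automorphism.ess_bounded_r[OF swap])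

definition pull :: "('a \<Rightarrow> complex) set \<Rightarrow> ('a \<Rightarrow> complex) set" where
  "pull J = {f \<in> ess_bounded M. (\<lambda>x. f (r x)) \<in> J}"

text \<open>If \<open>f\<close> is outside \<open>pull J\<close>, then \<open>f\<close> composed
  with \<open>r\<close> has an inverse modulo \<open>J\<close>, and composing that inverse with
  \<open>s\<close> inverts \<open>f\<close> modulo \<open>pull J\<close>. So an ideal strictly above
  \<open>pull J\<close> contains 1.\<close>

lemma maximal_pull:
  assumes "ess_bounded_maximal M J"
  shows "ess_bounded_maximal M (pull J)"
proof -
  interpret ess_bounded_maximal M J by fact
  interpret cring "ess_bounded_ring M"
    by (rule cring_ess_bounded_ring)
  have hom: "ring_hom_ring (ess_bounded_ring M) (ess_bounded_ring M) (\<lambda>f x. f (r x))"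
    by (intro ring_hom_ringI ring_axioms) (simp_all add: ess_bounded_r)
  have ideal: "ideal (pull J) (ess_bounded_ring M)"
    unfolding pull_def by (rule ring_hom_ring.ideal_vimage[OF hom J_ideal])
  show ?thesis
  proof (rule ess_bounded_maximal.intro)
    show "maximalideal (pull J) (ess_bounded_ring M)"
    proof (rule maximalidealI[OF ideal])
      have "(\<lambda>x. 1) \<in> ess_bounded M - pull J"
        using one_notin_J by (simp add: pull_def)
      then show "ess_bounded M \<noteq> pull J"
        by blast
      fix K assume K: "ideal K (ess_bounded_ring M)" "pull J \<subseteq> K" "K \<subseteq> ess_bounded M"
      show "K = pull J \<or> K = ess_bounded M"
      proof (cases "K \<subseteq> pull J")
        case False
        then obtain f where f: "f \<in> K" "f \<notin> pull J"
          by blast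
        then have f': "f \<in> ess_bounded M" "(\<lambda>x. f (r x)) \<notin> J"
          using K(3) by (auto simp: pull_def)
        obtain g where g: "g \<in> ess_bounded M" "(\<lambda>x. 1 - g x * f (r x)) \<in> J"
          by (rule J_inverse[OF ess_bounded_r[OF f'(1)] f'(2)])
        have gs: "(\<lambda>x. g (s x)) \<in> ess_bounded M"
          by (rule ess_bounded_s[OF g(1)])
        have "(\<lambda>x. 1 - g (s x) * f x) \<in> pull J"
          using g(2) by (auto simp: pull_def intro!: ess_bounded_diff ess_bounded_mult gs f'(1))
        then have "(\<lambda>x. 1 - g (s x) * f x) \<in> K"
          using K(2) by blast
        moreover have "(\<lambda>x. g (s x) * f x) \<in> K"
          using ideal.I_l_closed[OF K(1) f(1) gs] by simp
        ultimately have "\<one>\<^bsub>ess_bounded_ring M\<^esub> \<in> K"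
          using additive_subgroup.a_closed[OF ideal.axioms(1)[OF K(1)],
              of "\<lambda>x. 1 - g (s x) * f x" "\<lambda>x. g (s x) * f x"] by simp
        then show ?thesis
          using ideal.one_imp_carrier[OF K(1)] by blast
      qed (use K(2) in blast)
    qed
    show "null_functions M \<subseteq> pull J"
    proof
      fix f assume f: "f \<in> null_functions M"
      then have "(\<lambda>x. f (r x)) \<in> null_functions M"
        using AE_r[of "\<lambda>x. f x = 0"] by (auto simp: null_functions_def)
      moreover have "f \<in> ess_bounded M"
        using f null_subset J_bounded by blast
      ultimately show "f \<in> pull J"
        using null_subset by (auto simp: pull_def)
    qed
  qed
qed

definition spectrum_map :: "('a \<Rightarrow> complex) set set \<Rightarrow> ('a \<Rightarrow> complex) set set" where
  "spectrum_map I = ess_class M ` pull (\<Union>I)"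

lemma spectrum_map:
  assumes "I \<in> maximal_ideals M"
  shows "spectrum_map I \<in> maximal_ideals M" "\<Union>(spectrum_map I) = pull (\<Union>I)"
  unfolding spectrum_map_def
  by (rule image_in_maximal_ideals[OF maximal_pull[OF ess_bounded_maximal_Union[OF assms]]])+

lemma character_spectrum_map:
  assumes I: "I \<in> maximal_ideals M" and f: "f \<in> ess_bounded M"
  shows "character (spectrum_map I) f = character I (\<lambda>x. f (r x))"
proof -
  interpret I: ess_bounded_maximal M "\<Union>I"
    by (rule ess_bounded_maximal_Union[OF I])
  interpret rI: ess_bounded_maximal M "\<Union>(spectrum_map I)"
    by (rule ess_bounded_maximal_Union[OF spectrum_map(1)[OF I]])
  show ?thesis
  proof (rule rI.val_eqI[OF f])
    show "(\<lambda>x. f x - I.val (\<lambda>x. f (r x))) \<in> \<Union>(spectrum_map I)"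
      unfolding spectrum_map(2)[OF I] pull_def
      using I.val_in_J[OF ess_bounded_r[OF f]] by (auto intro!: ess_bounded_diff f simp del: Union_iff)
  qed
qed

text \<open>The preimage of the subbasic set given by \<open>f\<close> is the subbasic set given by
  \<open>f\<close> composed with \<open>r\<close>.\<close>

lemma continuous_spectrum_map:
  "continuous_map (maximal_ideal_space M) (maximal_ideal_space M) spectrum_map"
proof -
  let ?S = "{{I \<in> maximal_ideals M. gelfand_transform M F I \<in> U} | F U.
        F \<in> carrier (L_infinity M) \<and> open U}"
  have "continuous_map (maximal_ideal_space M) (topology_generated_by ?S) spectrum_map"
  proof (rule continuous_on_generated_topo)
    fix V assume "V \<in> ?S"
    then obtain f U where f: "f \<in> ess_bounded M" "open U"
      and V: "V = {I \<in> maximal_ideals M. gelfand_transform M (ess_class M f) I \<in> U}"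
      by (auto simp: carrier_L_infinity)
    have "spectrum_map -` V \<inter> topspace (maximal_ideal_space M)
        = {I \<in> maximal_ideals M. gelfand_transform M (ess_class M (\<lambda>x. f (r x))) I \<in> U}"
      unfolding V topspace_maximal_ideal_space
      by (auto simp: gelfand_transform_ess_class spectrum_map(1) f ess_bounded_r character_spectrum_map)
    moreover have "ess_class M (\<lambda>x. f (r x)) \<in> carrier (L_infinity M)"
      using ess_bounded_r[OF f(1)] by (simp add: carrier_L_infinity)
    ultimately show "openin (maximal_ideal_space M) (spectrum_map -` V \<inter> topspace (maximal_ideal_space M))"
      unfolding maximal_ideal_space_def using f(2) by (auto intro!: topology_generated_by_Basis)
  next
    have "\<Union>?S = topspace (maximal_ideal_space M)"
      unfolding maximal_ideal_space_def by (simp only: topology_generated_by_topspace)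
    then show "spectrum_map ` topspace (maximal_ideal_space M) \<subseteq> \<Union>?S"
      using spectrum_map(1) by (auto simp only: topspace_maximal_ideal_space)
  qed
  then show ?thesis
    by (simp only: maximal_ideal_space_def)
qed

lemma spectrum_map_inverse:
  assumes I: "I \<in> maximal_ideals M"
  shows "nonsingular_automorphism.spectrum_map M s (spectrum_map I) = I"
proof -
  interpret s: nonsingular_automorphism M s r
    by (rule swap)
  interpret ess_bounded_maximal M "\<Union>I"
    by (rule ess_bounded_maximal_Union[OF I])
  have "s.pull (pull (\<Union>I)) = \<Union>I"
    using J_bounded s.ess_bounded_r by (auto simp add: s.pull_def pull_def simp del: Union_iff)
  then show ?thesis
    unfolding s.spectrum_map_def spectrum_map(2)[OF I] using image_Union_maximal_ideal[OF I] by simp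
qed

lemma homeomorphic_maps_spectrum_map:
  "homeomorphic_maps (maximal_ideal_space M) (maximal_ideal_space M)
     spectrum_map (nonsingular_automorphism.spectrum_map M s)"
proof -
  interpret s: nonsingular_automorphism M s r
    by (rule swap)
  show ?thesis
    unfolding homeomorphic_maps_def topspace_maximal_ideal_space
    using continuous_spectrum_map s.continuous_spectrum_map spectrum_map_inverse s.spectrum_map_inverse
    by blast
qed

lemma character_spectrum_map_funpow:
  assumes "I \<in> maximal_ideals M" "f \<in> ess_bounded M"
  shows "(spectrum_map ^^ n) I \<in> maximal_ideals M \<and>
    character ((spectrum_map ^^ n) I) f = character I (\<lambda>x. f ((r ^^ n) x))"
  using assms(2)
proof (induction n arbitrary: f)
  case (Suc n)
  have "(spectrum_map ^^ n) I \<in> maximal_ideals M"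
    using Suc by blast
  then show ?case
    using Suc.IH[OF ess_bounded_r[OF Suc.prems]] Suc.prems
    by (simp add: spectrum_map(1) character_spectrum_map)
qed (use assms(1) in simp)

end


section \<open>Rotations of the circle\<close>

text \<open>The measure before completion. Its measurable functions remain Borel after composition
  with \<open>cis\<close>, which allows integration over the real line.\<close>

definition borel_circle :: "complex measure" where
  "borel_circle = distr (restrict_space lborel {0..<2 * pi}) (restrict_space borel (sphere 0 1)) cis"

lemma circle_measure_eq: "circle_measure = completion borel_circle"
  by (simp add: circle_measure_def borel_circle_def)

lemma sets_borel_circle [measurable_cong]: "sets borel_circle = sets (restrict_space borel (sphere 0 1))"
  by (simp add: borel_circle_def)

lemma space_borel_circle [simp]: "space borel_circle = sphere 0 1"
  by (simp add: borel_circle_def space_restrict_space)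

lemma cis_measurable_circle [measurable]: "cis \<in> borel \<rightarrow>\<^sub>M restrict_space borel (sphere 0 1)"
proof (rule measurable_restrict_space2)
  show "cis \<in> borel_measurable borel"
    by (intro borel_measurable_continuous_onI continuous_intros)
qed simp

lemma borel_measurable_circle_cis:
  assumes "f \<in> borel_measurable borel_circle"
  shows "(\<lambda>t. f (cis t)) \<in> borel_measurable borel"
proof -
  have "cis \<in> borel \<rightarrow>\<^sub>M borel_circle"
    by measurable
  then show ?thesis
    using assms by (rule measurable_compose)
qed

lemma null_sets_lborel_translation:
  fixes S :: "real set"
  assumes "S \<in> null_sets lborel"
  shows "{t. c + t \<in> S} \<in> null_sets lborel"
proof -
  have S: "S \<in> sets borel"
    using assms by (auto simp: null_sets_def)
  have "emeasure (distr lborel borel ((+) c)) S = emeasure lborel ((+) c -` S \<inter> space lborel)"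
    using S by (intro emeasure_distr) simp_all
  then have "emeasure lborel ((+) c -` S) = 0"
    using assms by (simp add: lborel_distr_plus null_sets_def)
  moreover have "(+) c -` S \<in> sets borel"
    using S measurable_sets[of "(+) c" borel borel S] by simp
  ultimately show ?thesis
    by (simp add: null_sets_def vimage_def)
qed

text \<open>The full preimage under \<open>cis\<close> is a countable union of translates of its
  part in one period. Working with it instead of that part turns rotations of the circle into
  translations of the line, with no wrapping around.\<close>

lemma null_sets_borel_circle_iff:
  assumes N: "N \<in> sets borel_circle"
  shows "N \<in> null_sets borel_circle \<longleftrightarrow> {t. cis t \<in> N} \<in> null_sets lborel"
proof -
  define S where "S = {t \<in> {0..<2 * pi}. cis t \<in> N}"
  have cis_restrict: "cis \<in> restrict_space lborel {0..<2 * pi} \<rightarrow>\<^sub>M restrict_space borel (sphere 0 1)"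
    by (rule measurable_restrict_space1) measurable
  have vimage: "{t. cis t \<in> N} \<in> sets borel"
    using measurable_sets[OF cis_measurable_circle, of N] N by (simp add: sets_borel_circle vimage_def)
  have "S = {t. cis t \<in> N} \<inter> {0..<2 * pi}"
    by (auto simp: S_def)
  then have S: "S \<in> sets borel"
    using vimage by simp
  have "emeasure borel_circle N = emeasure (restrict_space lborel {0..<2 * pi}) S"
    unfolding borel_circle_def using N
    by (subst emeasure_distr[OF cis_restrict])
      (auto simp: sets_borel_circle S_def space_restrict_space intro!: arg_cong2[where f = emeasure])
  also have "\<dots> = emeasure lborel S"
    by (rule emeasure_restrict_space) (auto simp: S_def)
  finally have "N \<in> null_sets borel_circle \<longleftrightarrow> S \<in> null_sets lborel"
    using N S by (simp add: null_sets_def)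
  also have "\<dots> \<longleftrightarrow> {t. cis t \<in> N} \<in> null_sets lborel"
  proof
    assume null: "S \<in> null_sets lborel"
    have "{t. cis t \<in> N} = (\<Union>k::int. {t. of_int k * (2 * pi) + t \<in> S})"
    proof (intro equalityI subsetI)
      fix t assume t: "t \<in> {t. cis t \<in> N}"
      define k where "k = - \<lfloor>t / (2 * pi)\<rfloor>"
      have "of_int k * (2 * pi) + t \<in> {0..<2 * pi}"
        using floor_divide_lower[of "2 * pi" t] floor_divide_upper[of "2 * pi" t]
        by (simp add: k_def algebra_simps)
      moreover have "cis (of_int k * (2 * pi) + t) = cis t"
        by (simp add: cis_mult[symmetric] mult.commute[of _ "2 * pi"])
      ultimately have "of_int k * (2 * pi) + t \<in> S"
        using t by (simp add: S_def)
      then show "t \<in> (\<Union>k::int. {t. of_int k * (2 * pi) + t \<in> S})"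
        by blast
    next
      fix t assume "t \<in> (\<Union>k::int. {t. of_int k * (2 * pi) + t \<in> S})"
      then obtain k :: int where "cis (of_int k * (2 * pi) + t) \<in> N"
        by (auto simp: S_def)
      moreover have "cis (of_int k * (2 * pi) + t) = cis t"
        by (simp add: cis_mult[symmetric] mult.commute[of _ "2 * pi"])
      ultimately show "t \<in> {t. cis t \<in> N}"
        by simp
    qed
    also have "\<dots> \<in> null_sets lborel"
      by (intro null_sets_UN null_sets_lborel_translation null)
    finally show "{t. cis t \<in> N} \<in> null_sets lborel" .
  next
    assume "{t. cis t \<in> N} \<in> null_sets lborel"
    then show "S \<in> null_sets lborel"
      by (rule null_sets_subset) (use S in \<open>auto simp: S_def\<close>)
  qed
  finally show ?thesis .
qed

lemma AE_circle_cis: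
  assumes "AE z in circle_measure. P z"
  shows "AE t in lborel. P (cis t)"
proof -
  have "AE z in borel_circle. P z"
    using assms unfolding circle_measure_eq by (rule AE_completion_iff[THEN iffD1])
  then obtain N where N: "{z \<in> space borel_circle. \<not> P z} \<subseteq> N" "N \<in> null_sets borel_circle"
    by (auto elim!: AE_E simp: null_sets_def)
  have "{t. cis t \<in> N} \<in> null_sets lborel"
    using null_sets_borel_circle_iff N(2) by blast
  then show ?thesis
    by (rule AE_I') (use N(1) in auto)
qed

lemma rotation_measurable: "(*) (cis a) \<in> borel_circle \<rightarrow>\<^sub>M borel_circle"
proof -
  have "(*) (cis a) \<in> restrict_space borel (sphere 0 1) \<rightarrow>\<^sub>M restrict_space borel (sphere 0 1)"
  proof (rule measurable_restrict_space2)
    show "(*) (cis a) \<in> borel_measurable (restrict_space borel (sphere 0 1))"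
      by (intro borel_measurable_continuous_on_restrict continuous_intros)
  qed (auto simp: space_restrict_space norm_mult)
  then show ?thesis
    by (simp cong: measurable_cong_sets add: sets_borel_circle)
qed

lemma rotation_null_sets:
  assumes N: "N \<in> null_sets borel_circle"
  shows "(*) (cis a) -` N \<inter> sphere 0 1 \<in> null_sets borel_circle"
proof -
  have "{t. cis t \<in> N} \<in> null_sets lborel"
    using null_sets_borel_circle_iff N by blast
  then have "{t. a + t \<in> {t. cis t \<in> N}} \<in> null_sets lborel"
    by (rule null_sets_lborel_translation)
  moreover have "{t. cis t \<in> (*) (cis a) -` N \<inter> sphere 0 1} = {t. a + t \<in> {t. cis t \<in> N}}"
    by (auto simp: cis_mult)
  moreover have "(*) (cis a) -` N \<inter> sphere 0 1 \<in> sets borel_circle"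
    using measurable_sets[OF rotation_measurable, of N a] N by (auto simp: null_sets_def)
  ultimately show ?thesis
    using null_sets_borel_circle_iff by metis
qed

lemma rotation_null_sets_completion:
  assumes "N \<in> null_sets circle_measure"
  shows "(*) (cis a) -` N \<inter> space circle_measure \<in> null_sets circle_measure"
proof -
  obtain N' where N': "N' \<in> null_sets borel_circle" "N \<subseteq> N'"
    using assms by (auto simp: circle_measure_eq null_sets_completion_iff2)
  show ?thesis
    unfolding circle_measure_eq null_sets_completion_iff2
    using rotation_null_sets[OF N'(1), of a] N'(2) by (intro bexI) auto
qed

text \<open>Measurability into a completion needs preimages of null sets to be null, not just Borel
  measurability; rotations satisfy this.\<close>

lemma rotation_measurable_completion: "(*) (cis a) \<in> circle_measure \<rightarrow>\<^sub>M circle_measure"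
proof -
  have meas: "(*) (cis a) \<in> completion borel_circle \<rightarrow>\<^sub>M borel_circle"
    by (rule measurable_completion[OF rotation_measurable])
  show ?thesis
    unfolding circle_measure_eq
  proof (rule completion.measurable_completion2[OF meas], rule subsetI)
    fix N assume N: "N \<in> null_sets borel_circle"
    have "(*) (cis a) -` N \<inter> sphere 0 1 \<in> null_sets (completion borel_circle)"
      by (intro null_sets_completionI rotation_null_sets N)
    then show "N \<in> null_sets (distr (completion borel_circle) borel_circle ((*) (cis a)))"
      using N meas by (auto simp: null_sets_def emeasure_distr)
  qed
qed

lemma rotation_automorphism: "nonsingular_automorphism circle_measure ((*) (cis a)) ((*) (cis (- a)))"
proof
  show "cis a * (cis (- a) * z) = z" "cis (- a) * (cis a * z) = z" for z
    by (simp_all add: mult.assoc[symmetric] cis_mult)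
qed (intro rotation_measurable_completion rotation_null_sets_completion, assumption?)+

lemma rotation_funpow: "((*) (cis a) ^^ n) z = cis (of_nat n * a) * z"
  by (induction n) (simp_all add: mult.assoc[symmetric] cis_mult algebra_simps)


section \<open>Bounded Borel representatives and their averages\<close>

text \<open>Asks for a real Borel function that is bounded everywhere, not merely an essentially
  bounded one, so that its composition with \<open>cis\<close> can be integrated over compact
  intervals without exceptional sets.\<close>

definition represents :: "(complex \<Rightarrow> real) \<Rightarrow> ((complex \<Rightarrow> complex) set set \<Rightarrow> real) \<Rightarrow> bool" where
  "represents f h \<longleftrightarrow> f \<in> borel_measurable borel_circle \<and> (\<exists>C. \<forall>z. \<bar>f z\<bar> \<le> C) \<and>
     (\<forall>I\<in>maximal_ideals circle_measure. character I (\<lambda>z. of_real (f z)) = of_real (h I))"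

lemma ess_bounded_circle:
  fixes f :: "complex \<Rightarrow> real"
  assumes "f \<in> borel_measurable borel_circle" "\<exists>C. \<forall>z. \<bar>f z\<bar> \<le> C"
  shows "(\<lambda>z. of_real (f z)) \<in> ess_bounded circle_measure"
proof -
  obtain C where C: "\<bar>f z\<bar> \<le> C" for z
    using assms(2) by blast
  show ?thesis
  proof (rule ess_boundedI)
    have [measurable]: "f \<in> borel_measurable circle_measure"
      unfolding circle_measure_eq using assms(1) by (rule measurable_completion)
    show "(\<lambda>z. complex_of_real (f z)) \<in> borel_measurable circle_measure"
      by measurable
    show "AE z in circle_measure. norm (complex_of_real (f z)) \<le> C"
      using C by simp
  qed
qed

lemma represents_ess_bounded: "represents f h \<Longrightarrow> (\<lambda>z. of_real (f z)) \<in> ess_bounded circle_measure"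
  by (auto simp: represents_def intro: ess_bounded_circle)

lemma ex_represents:
  assumes "continuous_map (maximal_ideal_space circle_measure) euclidean h"
  shows "\<exists>f. represents f h"
proof -
  obtain f :: "complex \<Rightarrow> real" where f: "(\<lambda>z. of_real (f z)) \<in> ess_bounded circle_measure"
    and char_f: "\<And>I. I \<in> maximal_ideals circle_measure \<Longrightarrow> character I (\<lambda>z. of_real (f z)) = of_real (h I)"
    using ex_representative[OF assms] by blast
  obtain C where C: "AE z in circle_measure. \<bar>f z\<bar> \<le> C"
    using f by (auto simp: ess_bounded_iff)
  have "(\<lambda>z. Re (of_real (f z))) \<in> borel_measurable circle_measure"
    using f by (intro measurable_compose[OF _ borel_measurable_Re]) (simp add: ess_bounded_iff)
  then have "f \<in> borel_measurable (completion borel_circle)"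
    by (simp add: circle_measure_eq)
  from completion_ex_borel_measurable_real[OF this]
  obtain g where g [measurable]: "g \<in> borel_measurable borel_circle" and "AE z in borel_circle. f z = g z"
    by blast
  then have fg: "AE z in circle_measure. f z = g z"
    unfolding circle_measure_eq by (intro AE_completion)
  \<comment> \<open>Truncation makes the essential bound a bound everywhere and changes
    \<open>g\<close> on a null set only; \<open>\<bar>C\<bar>\<close> instead of \<open>C\<close>
    keeps the interval nonempty.\<close>
  define k where "k z = max (- \<bar>C\<bar>) (min \<bar>C\<bar> (g z))" for z
  have k: "k \<in> borel_measurable borel_circle" "\<exists>C. \<forall>z. \<bar>k z\<bar> \<le> C"
    unfolding k_def by (measurable, intro exI[of _ "\<bar>C\<bar>"]) auto
  have "AE z in circle_measure. complex_of_real (f z) = of_real (k z)"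
    using C fg by eventually_elim (auto simp: k_def)
  moreover have "(\<lambda>z. complex_of_real (k z)) \<in> borel_measurable circle_measure"
    using ess_bounded_circle[OF k] by (simp add: ess_bounded_iff)
  ultimately have "character I (\<lambda>z. of_real (k z)) = of_real (h I)"
    if I: "I \<in> maximal_ideals circle_measure" for I
    using ess_bounded_maximal.val_AE_cong[OF ess_bounded_maximal_Union[OF I] f] char_f[OF I] by metis
  then show ?thesis
    using k unfolding represents_def by blast
qed

lemma represents_add:
  assumes f: "represents f h" and g: "represents g k"
  shows "represents (\<lambda>z. f z + g z) (\<lambda>I. h I + k I)"
proof -
  obtain C D where "\<bar>f z\<bar> \<le> C" "\<bar>g z\<bar> \<le> D" for z
    using f g unfolding represents_def by metis
  then have "\<bar>f z + g z\<bar> \<le> C + D" for z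
    using abs_triangle_ineq add_mono order_trans by meson
  moreover have "character I (\<lambda>z. of_real (f z + g z)) = of_real (h I + k I)"
    if I: "I \<in> maximal_ideals circle_measure" for I
    using ess_bounded_maximal.val_add[OF ess_bounded_maximal_Union[OF I] f[THEN represents_ess_bounded]
        g[THEN represents_ess_bounded]] f g I
    by (simp add: represents_def)
  ultimately show ?thesis
    using f g by (auto simp: represents_def)
qed

lemma represents_cmult:
  assumes f: "represents f h"
  shows "represents (\<lambda>z. c * f z) (\<lambda>I. c * h I)"
proof -
  obtain C where "\<bar>f z\<bar> \<le> C" for z
    using f unfolding represents_def by metis
  then have "\<bar>c * f z\<bar> \<le> \<bar>c\<bar> * C" for z
    by (simp add: abs_mult mult_left_mono)
  moreover have "character I (\<lambda>z. of_real (c * f z)) = of_real (c * h I)"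
    if I: "I \<in> maximal_ideals circle_measure" for I
    using ess_bounded_maximal.val_cmult[OF ess_bounded_maximal_Union[OF I] f[THEN represents_ess_bounded]] f I
    by (simp add: represents_def)
  ultimately show ?thesis
    using f by (auto simp: represents_def)
qed

abbreviation rotate_spectrum :: "real \<Rightarrow> (complex \<Rightarrow> complex) set set \<Rightarrow> (complex \<Rightarrow> complex) set set" where
  "rotate_spectrum a \<equiv> nonsingular_automorphism.spectrum_map circle_measure ((*) (cis a))"

lemma rotate_spectrum_funpow_in:
  "I \<in> maximal_ideals circle_measure \<Longrightarrow> (rotate_spectrum a ^^ n) I \<in> maximal_ideals circle_measure"
  using nonsingular_automorphism.character_spectrum_map_funpow[OF rotation_automorphism]
    ess_bounded_const by blast

lemma represents_rotate:
  assumes f: "represents f h"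
  shows "represents (\<lambda>z. f (cis (of_nat n * a) * z))
    (\<lambda>I. if I \<in> maximal_ideals circle_measure then h ((rotate_spectrum a ^^ n) I) else 0)"
proof -
  have "(\<lambda>z. f (cis (of_nat n * a) * z)) \<in> borel_measurable borel_circle"
    using f by (intro measurable_compose[OF rotation_measurable]) (simp add: represents_def)
  moreover have "character I (\<lambda>z. of_real (f (cis (of_nat n * a) * z))) = of_real (h ((rotate_spectrum a ^^ n) I))"
    if I: "I \<in> maximal_ideals circle_measure" for I
  proof -
    have "character ((rotate_spectrum a ^^ n) I) (\<lambda>z. of_real (f z))
        = character I (\<lambda>z. of_real (f (((*) (cis a) ^^ n) z)))"
      using nonsingular_automorphism.character_spectrum_map_funpow[OF rotation_automorphism I
          f[THEN represents_ess_bounded]] by blast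
    then show ?thesis
      using f rotate_spectrum_funpow_in[OF I] by (simp add: represents_def rotation_funpow)
  qed
  ultimately show ?thesis
    using f by (auto simp: represents_def)
qed

lemma represents_AE_le:
  assumes f: "represents f h" and h: "\<And>I. I \<in> maximal_ideals circle_measure \<Longrightarrow> \<bar>h I\<bar> \<le> B"
  shows "AE t in lborel. \<bar>f (cis t)\<bar> \<le> B"
proof -
  have "AE z in circle_measure. norm (complex_of_real (f z)) \<le> B"
  proof (rule AE_norm_le_if_characters_le[OF represents_ess_bounded[OF f]])
    fix I assume "I \<in> maximal_ideals circle_measure"
    then show "norm (character I (\<lambda>z. of_real (f z))) \<le> B"
      using f h by (simp add: represents_def)
  qed
  then show ?thesis
    by (intro AE_circle_cis) simp
qed

lemma represents_bound:
  assumes f: "represents f h"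
  shows "\<exists>C. \<forall>I\<in>maximal_ideals circle_measure. \<bar>h I\<bar> \<le> C"
proof -
  obtain C where C: "\<bar>f z\<bar> \<le> C" for z
    using f unfolding represents_def by metis
  have "\<bar>h I\<bar> \<le> C" if I: "I \<in> maximal_ideals circle_measure" for I
    using ess_bounded_maximal.norm_val_le[OF ess_bounded_maximal_Union[OF I] f[THEN represents_ess_bounded], of C]
      C f I by (simp add: represents_def)
  then show ?thesis
    by blast
qed

lemma represents_eq_0:
  assumes f: "represents f h" and zero: "AE t in lborel. t \<ge> 0 \<longrightarrow> f (cis t) = 0"
    and I: "I \<in> maximal_ideals circle_measure"
  shows "h I = 0"
proof -
  have [measurable]: "f \<in> borel_measurable borel_circle"
    using f by (simp add: represents_def)
  have "AE t in restrict_space lborel {0..<2 * pi}. f (cis t) = 0"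
    by (subst AE_restrict_space_iff) (use zero in \<open>auto elim!: eventually_mono\<close>)
  moreover have "cis \<in> restrict_space lborel {0..<2 * pi} \<rightarrow>\<^sub>M restrict_space borel (sphere 0 1)"
    by (rule measurable_restrict_space1) measurable
  moreover have "{z \<in> space borel_circle. f z = 0} \<in> sets borel_circle"
    by measurable
  ultimately have "AE z in borel_circle. f z = 0"
    unfolding borel_circle_def by (subst AE_distr_iff) simp_all
  then have "AE z in circle_measure. 0 = complex_of_real (f z)"
    unfolding circle_measure_eq AE_completion_iff by eventually_elim simp
  moreover have "(\<lambda>z. complex_of_real (f z)) \<in> borel_measurable circle_measure"
    using represents_ess_bounded[OF f] by (simp add: ess_bounded_iff)
  ultimately have "character I (\<lambda>z. of_real (f z)) = character I (\<lambda>z. 0)"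
    by (intro ess_bounded_maximal.val_AE_cong[OF ess_bounded_maximal_Union[OF I]]) auto
  then show ?thesis
    using f I by (simp add: represents_def ess_bounded_maximal.val_const[OF ess_bounded_maximal_Union[OF I]])
qed

text \<open>The factor \<open>1/2\<close> makes the complexification of this functional a contraction without a rotation
  argument.\<close>

definition average :: "(complex \<Rightarrow> real) \<Rightarrow> real" where
  "average f = integral {0..2 * pi} (\<lambda>t. f (cis t) * exp (- t)) / 2"

lemma represents_integrable:
  assumes "represents f h"
  shows "(\<lambda>t. f (cis t) * exp (- t)) integrable_on {0..2 * pi}"
proof -
  have [measurable]: "(\<lambda>t. f (cis t)) \<in> borel_measurable borel"
    using assms by (intro borel_measurable_circle_cis) (simp add: represents_def)
  obtain C where C: "\<bar>f z\<bar> \<le> C" for z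
    using assms unfolding represents_def by metis
  show ?thesis
  proof (rule integrable_on_bounded_borel)
    show "\<bar>f (cis t) * exp (- t)\<bar> \<le> C * 1" if "t \<in> {0..2 * pi}" for t
      unfolding abs_mult using C[of "cis t"] that by (intro mult_mono) auto
  qed measurable
qed

lemma average_AE_cong:
  assumes "AE t in lborel. f (cis t) = g (cis t)"
  shows "average f = average g"
proof -
  obtain N where N: "{t. f (cis t) \<noteq> g (cis t)} \<subseteq> N" "N \<in> null_sets lborel"
    using assms by (auto elim!: AE_E simp: null_sets_def)
  have "negligible N"
    using N(2) by (simp add: negligible_iff_null_sets null_sets_completionI)
  then have "integral {0..2 * pi} (\<lambda>t. g (cis t) * exp (- t)) = integral {0..2 * pi} (\<lambda>t. f (cis t) * exp (- t))"
    by (rule integral_spike) (use N(1) in auto)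
  then show ?thesis
    by (simp add: average_def)
qed

text \<open>The weight has mass \<open>1 - exp (- (2 * pi))\<close>, which is less than 1, over a
  period; halving gives \<open>B / 2\<close>.\<close>

lemma average_bound:
  assumes f: "represents f h" and le: "AE t in lborel. \<bar>f (cis t)\<bar> \<le> B"
  shows "\<bar>average f\<bar> \<le> B / 2"
proof -
  have B: "0 \<le> B"
  proof (rule ccontr)
    assume "\<not> 0 \<le> B"
    with le have "AE t :: real in lborel. False"
      by (auto elim!: eventually_mono)
    then show False
      using AE_iff_null[of lborel "\<lambda>t :: real. False"] by (simp add: null_sets_def)
  qed
  \<comment> \<open>The integral estimate wants a bound at every point, whereas the hypothesis holds
    almost everywhere; truncating does not change the average.\<close>
  define g where "g z = max (- B) (min B (f z))" for z
  have "AE t in lborel. f (cis t) = g (cis t)"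
    using le by eventually_elim (auto simp: g_def)
  then have "average f = average g"
    by (rule average_AE_cong)
  have g_le: "\<bar>g z\<bar> \<le> B" for z
    using B by (auto simp: g_def)
  have [measurable]: "(\<lambda>t. f (cis t)) \<in> borel_measurable borel"
    using f by (intro borel_measurable_circle_cis) (simp add: represents_def)
  have g_bound: "\<bar>g (cis t) * exp (- t)\<bar> \<le> B * exp (- t)" for t
    unfolding abs_mult using g_le[of "cis t"] by (simp add: mult_right_mono)
  have exp_integral: "((\<lambda>t. B * exp (- t)) has_integral (- B * exp (- (2 * pi)) - (- B * exp (- 0)))) {0..2 * pi}"
    by (rule fundamental_theorem_of_calculus)
      (auto intro!: derivative_eq_intros simp flip: has_real_derivative_iff_has_vector_derivative)
  have "norm (integral {0..2 * pi} (\<lambda>t. g (cis t) * exp (- t))) \<le> integral {0..2 * pi} (\<lambda>t. B * exp (- t))"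
  proof (rule integral_norm_bound_integral)
    show "(\<lambda>t. g (cis t) * exp (- t)) integrable_on {0..2 * pi}"
    proof (rule integrable_on_bounded_borel)
      show "(\<lambda>t. g (cis t) * exp (- t)) \<in> borel_measurable borel"
        unfolding g_def by measurable
      show "\<bar>g (cis t) * exp (- t)\<bar> \<le> B * 1" if "t \<in> {0..2 * pi}" for t
        unfolding abs_mult using g_le[of "cis t"] B that by (intro mult_mono) auto
    qed
    show "(\<lambda>t. B * exp (- t)) integrable_on {0..2 * pi}"
      using exp_integral by (rule has_integral_integrable)
  qed (use g_bound in auto)
  also have "\<dots> = B * (1 - exp (- (2 * pi)))"
    using integral_unique[OF exp_integral] by (simp add: algebra_simps)
  also have "\<dots> \<le> B"
    using B by (simp add: mult_left_le)
  finally show ?thesis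
    unfolding \<open>average f = average g\<close> by (simp add: average_def)
qed

lemma average_add:
  assumes "represents f h" "represents g k"
  shows "average (\<lambda>z. f z + g z) = average f + average g"
  unfolding average_def distrib_right
  by (simp add: integral_add[OF assms[THEN represents_integrable]] add_divide_distrib)

lemma average_cmult: "average (\<lambda>z. c * f z) = c * average f"
  by (simp add: average_def mult.assoc)

section \<open>The averaging functional on the maximal ideal space\<close>

definition functional :: "((complex \<Rightarrow> complex) set set \<Rightarrow> real) \<Rightarrow> real" where
  "functional h = average (SOME f. represents f h)"

text \<open>The difference of two representatives of \<open>h\<close> represents 0, so it vanishes
  almost everywhere and the average does not depend on the choice.\<close>

lemma functional_eq:
  assumes f: "represents f h"
  shows "functional h = average f"
proof -
  define g where "g = (SOME f. represents f h)"
  have g: "represents g h"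
    unfolding g_def using f by (rule someI[of "\<lambda>f. represents f h"])
  have "represents (\<lambda>z. g z + (-1) * f z) (\<lambda>I. h I + (-1) * h I)"
    by (intro represents_add represents_cmult f g)
  then have "AE t in lborel. \<bar>g (cis t) + (-1) * f (cis t)\<bar> \<le> 0"
    by (rule represents_AE_le) simp
  then have "AE t in lborel. g (cis t) = f (cis t)"
    by eventually_elim simp
  then show ?thesis
    unfolding functional_def g_def[symmetric] by (rule average_AE_cong)
qed

abbreviation real_spectrum_functions :: "((complex \<Rightarrow> complex) set set \<Rightarrow> real) set" where
  "real_spectrum_functions \<equiv> continuous_functions (maximal_ideal_space circle_measure)"

lemma ex_represents_real:
  assumes "h \<in> real_spectrum_functions"
  obtains f where "represents f h"
  using ex_represents assms by (auto simp: continuous_functions_def)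

lemma functional_add:
  assumes "h \<in> real_spectrum_functions" "k \<in> real_spectrum_functions"
  shows "functional (\<lambda>I. h I + k I) = functional h + functional k"
proof -
  obtain f g where fg: "represents f h" "represents g k"
    using assms ex_represents_real by metis
  show ?thesis
    unfolding functional_eq[OF fg(1)] functional_eq[OF fg(2)] functional_eq[OF represents_add[OF fg]]
    by (rule average_add[OF fg])
qed

lemma functional_cmult:
  assumes "h \<in> real_spectrum_functions"
  shows "functional (\<lambda>I. c * h I) = c * functional h"
proof -
  obtain f where f: "represents f h"
    using assms by (rule ex_represents_real)
  show ?thesis
    by (simp add: functional_eq[OF f] functional_eq[OF represents_cmult[OF f]] average_cmult)
qed

lemma functional_bound:
  assumes "h \<in> real_spectrum_functions" "\<And>I. \<bar>h I\<bar> \<le> B"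
  shows "\<bar>functional h\<bar> \<le> B / 2"
proof -
  obtain f where f: "represents f h"
    using assms(1) by (rule ex_represents_real)
  show ?thesis
    unfolding functional_eq[OF f] by (rule average_bound[OF f represents_AE_le[OF f assms(2)]])
qed

lemma real_spectrum_functions_bounded:
  assumes "h \<in> real_spectrum_functions"
  shows "\<exists>B. \<forall>I. \<bar>h I\<bar> \<le> B"
proof -
  obtain f where f: "represents f h"
    using assms(1) by (rule ex_represents_real)
  obtain C where "\<bar>h I\<bar> \<le> C" if "I \<in> maximal_ideals circle_measure" for I
    using represents_bound[OF f] by blast
  then have "\<bar>h I\<bar> \<le> \<bar>C\<bar>" for I
    using assms by (cases "I \<in> maximal_ideals circle_measure")
      (force simp: continuous_functions_def topspace_maximal_ideal_space)+
  then show ?thesis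
    by blast
qed

text \<open>Rotating the spectrum \<open>n\<close> times translates the argument of the periodic
  function \<open>f (cis t)\<close> by \<open>n\<close> times the angle, so the hypothesis is, up to
  the factor 1/2, that of the criterion for periodic functions.\<close>

lemma functional_separating:
  assumes irrational: "\<theta> \<notin> \<rat>" and h: "h \<in> real_spectrum_functions"
    and conv: "convergent (\<lambda>n. (-1) ^ n * functional (\<lambda>I.
      if I \<in> topspace (maximal_ideal_space circle_measure) then h ((rotate_spectrum (2 * pi * \<theta>) ^^ n) I) else 0))"
  shows "h = (\<lambda>I. 0)"
proof -
  obtain f where f: "represents f h"
    using h by (rule ex_represents_real)
  have "functional (\<lambda>I. if I \<in> topspace (maximal_ideal_space circle_measure)
        then h ((rotate_spectrum (2 * pi * \<theta>) ^^ n) I) else 0)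
      = integral {0..2 * pi} (\<lambda>t. f (cis (t + of_nat n * (2 * pi * \<theta>))) * exp (- t)) / 2" for n
    unfolding topspace_maximal_ideal_space functional_eq[OF represents_rotate[OF f]] average_def
    by (simp add: cis_mult add.commute)
  then have "(-1) ^ n * functional (\<lambda>I. if I \<in> topspace (maximal_ideal_space circle_measure)
        then h ((rotate_spectrum (2 * pi * \<theta>) ^^ n) I) else 0)
      = (1 / 2) * ((-1) ^ n *
        integral {0..2 * pi} (\<lambda>t. f (cis (t + of_nat n * (2 * pi * \<theta>))) * exp (- t)))" for n
    by simp
  then have conv': "convergent (\<lambda>n. (1 / 2) * ((-1) ^ n *
      integral {0..2 * pi} (\<lambda>t. f (cis (t + of_nat n * (2 * pi * \<theta>))) * exp (- t))))"
    using conv by (simp only:)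
  obtain C where C: "\<bar>f z\<bar> \<le> C" for z
    using f unfolding represents_def by metis
  have "AE t in lborel. t \<ge> 0 \<longrightarrow> f (cis t) = 0"
  proof (rule AE_eq_0_if_averages_convergent[OF irrational])
    show "(\<lambda>t. f (cis t)) \<in> borel_measurable borel"
      using f by (intro borel_measurable_circle_cis) (simp add: represents_def)
    show "f (cis (t + 2 * pi)) = f (cis t)" for t
      by (simp flip: cis_mult)
    show "convergent (\<lambda>n. (-1) ^ n *
        integral {0..2 * pi} (\<lambda>t. f (cis (t + of_nat n * (2 * pi * \<theta>))) * exp (- t)))"
      using conv' by (subst (asm) convergent_mult_const_iff) auto
  qed (rule C)
  then have "h I = 0" if "I \<in> maximal_ideals circle_measure" for I
    using represents_eq_0[OF f] that by blast
  then show ?thesis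
    using h by (auto simp: continuous_functions_def topspace_maximal_ideal_space fun_eq_iff)
qed

section \<open>Complexification and conclusion\<close>

definition complex_functional :: "((complex \<Rightarrow> complex) set set \<Rightarrow> complex) \<Rightarrow> complex" where
  "complex_functional h = Complex (functional (\<lambda>I. Re (h I))) (functional (\<lambda>I. Im (h I)))"

lemma Re_Im_continuous_functions:
  assumes "h \<in> continuous_functions Y"
  shows "(\<lambda>x. Re (h x)) \<in> continuous_functions Y" "(\<lambda>x. Im (h x)) \<in> continuous_functions Y"
proof -
  have h: "continuous_map Y euclidean h"
    using assms by (simp add: continuous_functions_def)
  have "continuous_map Y euclidean (Re \<circ> h)" "continuous_map Y euclidean (Im \<circ> h)"
    using h by (rule continuous_map_compose; simp add: continuous_on_Re continuous_on_Im)+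
  then show "(\<lambda>x. Re (h x)) \<in> continuous_functions Y" "(\<lambda>x. Im (h x)) \<in> continuous_functions Y"
    using assms by (simp_all add: continuous_functions_def o_def)
qed

theorem theorem3p1:
  fixes N :: "'n set"
  assumes "countable N" and "infinite N"
  defines "X \<equiv> plus_topology (maximal_ideal_space circle_measure)
                  (Alexandroff_compactification (discrete_topology N))"
  shows "C_admits_isometric_shift TYPE(real) X \<and> C_admits_isometric_shift TYPE(complex) X"
proof
  have "(\<rat> :: real set) \<noteq> UNIV"
    using countable_rat uncountable_UNIV_real by metis
  then obtain \<theta> :: real where \<theta>: "\<theta> \<notin> \<rat>"
    by blast
  define a where "a = 2 * pi * \<theta>"
  let ?Y = "maximal_ideal_space circle_measure"
  \<comment> \<open>The shift composes with the rotation by \<open>- a\<close>, so that the inverse,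
    whose powers occur in the separation condition, is the rotation by \<open>a\<close>.\<close>
  have homeo: "homeomorphic_maps ?Y ?Y (rotate_spectrum (- a)) (rotate_spectrum a)"
    by (rule homeomorphic_maps_sym[THEN iffD1,
          OF nonsingular_automorphism.homeomorphic_maps_spectrum_map[OF rotation_automorphism]])
  show "C_admits_isometric_shift TYPE(real) X"
    unfolding X_def
  proof (rule isometric_shift_on_sum[OF assms(1,2) homeo])
    show "norm (functional h) \<le> B" if "h \<in> real_spectrum_functions" "\<And>I. norm (h I) \<le> B" for B h
      using functional_bound[of h B] that order_trans[OF norm_ge_zero that(2)] by simp
    show "h = (\<lambda>I. 0)" if "h \<in> real_spectrum_functions"
        "convergent (\<lambda>n. (-1) ^ n * functional (\<lambda>I. if I \<in> topspace ?Y then h ((rotate_spectrum a ^^ n) I) else 0))" for h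
      by (rule functional_separating[OF \<theta> that[unfolded a_def]])
    show "\<exists>B. \<forall>I. norm (h I) \<le> B" if "h \<in> real_spectrum_functions" for h :: "_ \<Rightarrow> real"
      using real_spectrum_functions_bounded[OF that] by simp
  qed (rule functional_add functional_cmult; assumption)+
  show "C_admits_isometric_shift TYPE(complex) X"
    unfolding X_def
  proof (rule isometric_shift_on_sum[OF assms(1,2) homeo])
    fix h k :: "(complex \<Rightarrow> complex) set set \<Rightarrow> complex" and B :: real and c :: complex
    assume h: "h \<in> continuous_functions ?Y"
    note Re_Im = Re_Im_continuous_functions[OF h]
    show "complex_functional (\<lambda>I. h I + k I) = complex_functional h + complex_functional k"
      if "k \<in> continuous_functions ?Y"
      using functional_add[OF Re_Im(1) Re_Im_continuous_functions(1)[OF that]]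
        functional_add[OF Re_Im(2) Re_Im_continuous_functions(2)[OF that]]
      by (simp add: complex_functional_def complex_eq_iff)
    show "complex_functional (\<lambda>I. c * h I) = c * complex_functional h"
    proof -
      have "functional (\<lambda>I. Re c * Re (h I) + (- Im c) * Im (h I))
          = Re c * functional (\<lambda>I. Re (h I)) + (- Im c) * functional (\<lambda>I. Im (h I))"
        unfolding functional_cmult[OF Re_Im(1), symmetric] functional_cmult[OF Re_Im(2), symmetric]
        by (intro functional_add continuous_functions_cmult Re_Im)
      moreover have "functional (\<lambda>I. Re c * Im (h I) + Im c * Re (h I))
          = Re c * functional (\<lambda>I. Im (h I)) + Im c * functional (\<lambda>I. Re (h I))"
        unfolding functional_cmult[OF Re_Im(1), symmetric] functional_cmult[OF Re_Im(2), symmetric]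
        by (intro functional_add continuous_functions_cmult Re_Im)
      ultimately show ?thesis
        by (simp add: complex_functional_def complex_eq_iff)
    qed
    show "norm (complex_functional h) \<le> B" if B: "\<And>I. norm (h I) \<le> B"
    proof -
      \<comment> \<open>Real and imaginary part each contribute at most \<open>B / 2\<close>, so the
        sum of their moduli already bounds the norm by \<open>B\<close>.\<close>
      have "\<bar>functional (\<lambda>I. Re (h I))\<bar> \<le> B / 2" "\<bar>functional (\<lambda>I. Im (h I))\<bar> \<le> B / 2"
        using B abs_Re_le_cmod abs_Im_le_cmod order_trans
        by (intro functional_bound Re_Im; blast)+
      then show ?thesis
        using cmod_le[of "complex_functional h"] by (simp add: complex_functional_def)
    qed
    show "\<exists>B. \<forall>I. norm (h I) \<le> B"
    proof -
      obtain B C where "\<bar>Re (h I)\<bar> \<le> B" "\<bar>Im (h I)\<bar> \<le> C" for I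
        using Re_Im[THEN real_spectrum_functions_bounded] by blast
      then have "norm (h I) \<le> B + C" for I
        using cmod_le[of "h I"] add_mono order_trans by meson
      then show ?thesis
        by blast
    qed
    assume conv: "convergent (\<lambda>n. (-1) ^ n *
      complex_functional (\<lambda>I. if I \<in> topspace ?Y then h ((rotate_spectrum a ^^ n) I) else 0))"
    let ?T = "\<lambda>n k I. if I \<in> topspace ?Y then k ((rotate_spectrum a ^^ n) I) else 0"
    \<comment> \<open>The signs are real, so they pass to the real and imaginary parts and the real
      criterion applies to each part separately.\<close>
    have parts: "Re ((-1) ^ n * complex_functional (?T n h)) = (-1) ^ n * functional (?T n (\<lambda>I. Re (h I)))"
      "Im ((-1) ^ n * complex_functional (?T n h)) = (-1) ^ n * functional (?T n (\<lambda>I. Im (h I)))" for n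
      by (cases "even n"; simp add: complex_functional_def if_distrib cong: if_cong)+
    have "convergent (\<lambda>n. (-1) ^ n * functional (?T n (\<lambda>I. Re (h I))))"
      "convergent (\<lambda>n. (-1) ^ n * functional (?T n (\<lambda>I. Im (h I))))"
      unfolding parts[symmetric] using conv by (auto simp only: convergent_def intro: tendsto_Re tendsto_Im)
    note conv_parts = this[unfolded a_def]
    have "(\<lambda>I. Re (h I)) = (\<lambda>I. 0)" "(\<lambda>I. Im (h I)) = (\<lambda>I. 0)"
      by (rule functional_separating[OF \<theta> Re_Im(1) conv_parts(1)],
          rule functional_separating[OF \<theta> Re_Im(2) conv_parts(2)])
    then show "h = (\<lambda>I. 0)"
      by (simp add: fun_eq_iff complex_eq_iff)
  qed
qed

end
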